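(* Let $F$ be a $3$-partite graph that has a vertex $w$ adjacent to every other vertex of $F$. Then every $F$-saturated graph $G$ on $n$ vertices with $t_2(n)-o(n^{3/2})$ edges contains a complete bipartite subgraph on $(1-o(1))n$ vertices. Precisely: for every function $f(n)=o(n^{3/2})$ there is a function $g(n)=o(n)$ such that every $F$-saturated graph $G$ on $n$ vertices with at least $t_2(n)-f(n)$ edges contains a complete bipartite subgraph on at least $n-g(n)$ vertices.
   Context: A graph $G$ is $F$-saturated if $G$ contains no copy of $F$ as a (not necessarily induced) subgraph, but adding any new edge to $G$ creates a copy of $F$. $t_2(n)=\lfloor n^2/4\rfloor$ denotes the number of edges of the Turán graph $T_2(n)$, the complete bipartite graph on $n$ vertices with parts of sizes $\lfloor n/2\rfloor$ and $\lceil n/2\rceil$. A graph is $3$-partite if its vertex set can be partitioned into three independent sets. *)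

theory Defs
  imports Complex_Main "HOL-Library.Landau_Symbols"
begin

record 'a sgraph =
  verts :: "'a set"
  edges :: "'a set set"

definition fin_simple_graph :: "'a sgraph \<Rightarrow> bool" where
  "fin_simple_graph G \<longleftrightarrow>
     finite (verts G) \<and> (\<forall>e\<in>edges G. e \<subseteq> verts G \<and> card e = 2)"

definition add_edge :: "'a \<Rightarrow> 'a \<Rightarrow> 'a sgraph \<Rightarrow> 'a sgraph" where
  "add_edge u v G = G\<lparr>edges := insert {u, v} (edges G)\<rparr>"

definition contains_copy :: "'b sgraph \<Rightarrow> 'a sgraph \<Rightarrow> bool" where
  "contains_copy G F \<longleftrightarrow>
     (\<exists>\<phi>. inj_on \<phi> (verts F) \<and> \<phi> ` verts F \<subseteq> verts G \<and>
          (\<forall>e\<in>edges F. \<phi> ` e \<in> edges G))"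

definition saturated :: "'a sgraph \<Rightarrow> 'b sgraph \<Rightarrow> bool" where
  "saturated F G \<longleftrightarrow>
     \<not> contains_copy G F \<and>
     (\<forall>u\<in>verts G. \<forall>v\<in>verts G. u \<noteq> v \<and> {u, v} \<notin> edges G \<longrightarrow>
        contains_copy (add_edge u v G) F)"

definition independent_in :: "'a sgraph \<Rightarrow> 'a set \<Rightarrow> bool" where
  "independent_in G S \<longleftrightarrow> S \<subseteq> verts G \<and> (\<forall>u\<in>S. \<forall>v\<in>S. {u, v} \<notin> edges G)"

text \<open>As usual, parts may be empty, so every bipartite graph is also 3-partite.\<close>

definition three_partite :: "'a sgraph \<Rightarrow> bool" where
  "three_partite G \<longleftrightarrow>
     (\<exists>A B C. A \<union> B \<union> C = verts G \<and>
        A \<inter> B = {} \<and> A \<inter> C = {} \<and> B \<inter> C = {} \<and>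
        independent_in G A \<and> independent_in G B \<and> independent_in G C)"

definition subgraph :: "'a sgraph \<Rightarrow> 'a sgraph \<Rightarrow> bool" where
  "subgraph H G \<longleftrightarrow>
     fin_simple_graph H \<and> verts H \<subseteq> verts G \<and> edges H \<subseteq> edges G"

text \<open>
  Exactly one empty part is excluded: otherwise every edgeless graph would be complete
  bipartite, and every graph would have a spanning complete bipartite subgraph. The null
  graph (both parts empty) is admitted, so that a lower bound of at most 0 on the number
  of vertices of a complete bipartite subgraph is no condition.
\<close>

definition complete_bipartite :: "'a sgraph \<Rightarrow> bool" where
  "complete_bipartite H \<longleftrightarrow>
     (\<exists>A B. A \<inter> B = {} \<and> (A = {} \<longleftrightarrow> B = {}) \<and>
        verts H = A \<union> B \<and> edges H = {{a, b} | a b. a \<in> A \<and> b \<in> B})"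

definition t2 :: "nat \<Rightarrow> nat" where
  "t2 n = n\<^sup>2 div 4"

end

(*
  F embeds in the complete tripartite graph K(1,k,k) with k = |V(F)|, so every neighbourhood in G
  is K(k,k)-free and spans few edges. Hence the neighbourhood of a vertex of maximum degree and its
  complement form a partition with few inner edges, and in a maximum cut A, B only
  m = o(n^(3/2)) cross pairs are missing. Then
  - o(n^(1/2)) vertices (the set T) miss a linear number of cross pairs, and the vertices outside T
    have fewer than k neighbours outside T in their own part;
  - only o(n) vertices miss more than n^(1/2) cross pairs, and all of these can be deleted;
  - by K(k,k)-freeness each vertex of T has, among the vertices missing at most n^(1/2) cross
    pairs, O(n^(1/2)) neighbours in A or in B; these can all be deleted since |T| n^(1/2) = o(n).
  If u in A and v in B are still non-adjacent, the apex of the copy of F created by the edge uv lies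
  outside T, say in A. The piece of the copy around v is then joined only to vertices of A that
  miss at most n^(1/2) cross pairs, so it could be moved to a place where all cross edges are
  present, giving a copy of F in G, unless all occurrences of such a piece in B meet a set of
  O(n^(1/2)) vertices. There are at most 2^k kinds of pieces, so these sets too can be deleted
  in advance, together with everything at bounded distance from the deleted vertices.
*)

theory Submission
  imports Defs "HOL-Real_Asymp.Real_Asymp"
begin

section \<open>Counting related pairs\<close>

definition rdeg :: "('a \<Rightarrow> 'b \<Rightarrow> bool) \<Rightarrow> 'b set \<Rightarrow> 'a \<Rightarrow> nat" where
  "rdeg r Y x = card {y \<in> Y. r x y}"

text \<open>The relation is arbitrary so that adjacency, non-adjacency and vertex-edge incidence are
  all counted alike. Pairs are ordered: \<open>pairs adj A A\<close> counts each edge inside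
  \<open>A\<close> twice.\<close>

definition pairs :: "('a \<Rightarrow> 'b \<Rightarrow> bool) \<Rightarrow> 'a set \<Rightarrow> 'b set \<Rightarrow> nat" where
  "pairs r X Y = (\<Sum>x\<in>X. rdeg r Y x)"

lemma rdeg_le_card: "finite Y \<Longrightarrow> rdeg r Y x \<le> card Y"
  unfolding rdeg_def by (intro card_mono) auto

lemma rdeg_mono: "finite Y' \<Longrightarrow> Y \<subseteq> Y' \<Longrightarrow> rdeg r Y x \<le> rdeg r Y' x"
  unfolding rdeg_def by (intro card_mono) auto

lemma rdeg_Un:
  "finite Y \<Longrightarrow> finite Y' \<Longrightarrow> Y \<inter> Y' = {} \<Longrightarrow> rdeg r (Y \<union> Y') x = rdeg r Y x + rdeg r Y' x"
proof -
  assume a: "finite Y" "finite Y'" "Y \<inter> Y' = {}"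
  have "{y \<in> Y \<union> Y'. r x y} = {y \<in> Y. r x y} \<union> {y \<in> Y'. r x y}" by auto
  then show ?thesis unfolding rdeg_def using a by (simp add: card_Un_disjoint disjoint_iff)
qed

lemma rdeg_compl: "finite Y \<Longrightarrow> rdeg r Y x + rdeg (\<lambda>x y. \<not> r x y) Y x = card Y"
proof -
  assume a: "finite Y"
  have "Y = {y \<in> Y. r x y} \<union> {y \<in> Y. \<not> r x y}" by auto
  then have "card Y = card ({y \<in> Y. r x y} \<union> {y \<in> Y. \<not> r x y})" by simp
  also have "\<dots> = card {y \<in> Y. r x y} + card {y \<in> Y. \<not> r x y}"
    using a by (intro card_Un_disjoint) auto
  finally show ?thesis unfolding rdeg_def by simp
qed

lemma pairs_swap:
  assumes "finite X" "finite Y"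
  shows "pairs r X Y = pairs (\<lambda>y x. r x y) Y X"
proof -
  have c: "card {y \<in> Z. P y} = (\<Sum>y\<in>Z. if P y then 1 else 0)" if "finite Z" for Z :: "'c set" and P
    using that by (simp add: sum.If_cases Int_def)
  show ?thesis
    unfolding pairs_def rdeg_def using assms by (simp add: c sum.swap[of _ Y])
qed

lemma pairs_Un_left:
  "finite X \<Longrightarrow> finite X' \<Longrightarrow> X \<inter> X' = {} \<Longrightarrow> pairs r (X \<union> X') Y = pairs r X Y + pairs r X' Y"
  unfolding pairs_def by (rule sum.union_disjoint)

lemma pairs_Un_right:
  "finite Y \<Longrightarrow> finite Y' \<Longrightarrow> Y \<inter> Y' = {} \<Longrightarrow> pairs r X (Y \<union> Y') = pairs r X Y + pairs r X Y'"
  unfolding pairs_def by (simp add: rdeg_Un sum.distrib)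

lemma pairs_mono:
  assumes "finite X'" "finite Y'" "X \<subseteq> X'" "Y \<subseteq> Y'"
  shows "pairs r X Y \<le> pairs r X' Y'"
proof -
  have "pairs r X Y \<le> pairs r X Y'"
    unfolding pairs_def using assms by (intro sum_mono rdeg_mono) auto
  also have "\<dots> \<le> pairs r X' Y'"
    unfolding pairs_def using assms by (intro sum_mono2) auto
  finally show ?thesis .
qed

lemma pairs_compl:
  assumes "finite X" "finite Y"
  shows "pairs r X Y + pairs (\<lambda>x y. \<not> r x y) X Y = card X * card Y"
  unfolding pairs_def sum.distrib[symmetric] using assms by (simp add: rdeg_compl)

lemma pairs_ge:
  assumes "finite X" "\<And>x. x \<in> X \<Longrightarrow> real (rdeg r Y x) \<ge> c"
  shows "real (pairs r X Y) \<ge> real (card X) * c"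
  unfolding pairs_def of_nat_sum using sum_bounded_below[of X c "\<lambda>x. real (rdeg r Y x)"] assms by simp

lemma pairs_le:
  assumes "finite X" "\<And>x. x \<in> X \<Longrightarrow> real (rdeg r Y x) \<le> c"
  shows "real (pairs r X Y) \<le> real (card X) * c"
  unfolding pairs_def of_nat_sum using sum_bounded_above[of X "\<lambda>x. real (rdeg r Y x)" c] assms by simp

text \<open>Markov's inequality in counting form; it bounds the sets of vertices that miss many
  cross pairs.\<close>

lemma card_large_rdeg:
  assumes "finite X" "finite Y"
  shows "real (card {x \<in> X. real (rdeg r Y x) \<ge> c}) * c \<le> real (pairs r X Y)"
proof -
  have "real (card {x \<in> X. real (rdeg r Y x) \<ge> c}) * c \<le> real (pairs r {x \<in> X. real (rdeg r Y x) \<ge> c} Y)"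
    using assms by (intro pairs_ge) auto
  also have "\<dots> \<le> real (pairs r X Y)"
    using assms by (auto intro!: pairs_mono)
  finally show ?thesis .
qed

lemma pairs_insert_self:
  assumes "finite X" "t \<notin> X" "\<And>x y. r x y \<Longrightarrow> r y x" "\<And>x. \<not> r x x"
  shows "pairs r (insert t X) (insert t X) = pairs r X X + 2 * rdeg r X t"
proof -
  have 1: "pairs r {t} Z = rdeg r Z t" for Z by (simp add: pairs_def)
  have "(\<lambda>y x. r x y) = r" using assms(3) by blast
  then have 2: "pairs r X {t} = rdeg r X t"
    using pairs_swap[of X "{t}" r] assms(1) by (simp add: 1)
  have 3: "rdeg r {t} t = 0" using assms(4) by (simp add: rdeg_def)
  have "pairs r (insert t X) (insert t X) = pairs r ({t} \<union> X) ({t} \<union> X)" by simp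
  also have "\<dots> = pairs r X X + 2 * rdeg r X t"
    using assms(1,2) by (simp add: pairs_Un_left pairs_Un_right rdeg_Un 1 2 3 del: Un_insert_left Un_insert_right)
  finally show ?thesis .
qed

section \<open>The Kovari--Sos--Turan theorem in qualitative form\<close>

text \<open>Many elements of \<open>X\<close> have degree at least \<epsilon>n/2. Of these fix
  \<open>K\<close>: many elements of \<open>Y\<close> have at least \<open>s\<close> neighbours
  among them, and by pigeonhole over the \<open>2 ^ K\<close> possible traces, \<open>s\<close>
  elements of \<open>Y\<close> share the same trace.\<close>

lemma kst:
  fixes X :: "'a set" and Y :: "'b set"
  assumes fin: "finite X" "finite Y" and card: "card X \<le> n" "card Y \<le> n"
    and eps: "\<epsilon> > 0" and K: "real K * \<epsilon> \<ge> 4 * real s"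
    and n: "real n * \<epsilon> \<ge> 2 * real K" "n > 2 ^ K * K"
    and dense: "real (pairs r X Y) \<ge> \<epsilon> * real n ^ 2"
  shows "\<exists>S\<subseteq>X. \<exists>R\<subseteq>Y. card S = s \<and> card R = s \<and> (\<forall>x\<in>S. \<forall>y\<in>R. r x y)"
proof (cases "s = 0")
  case True
  then show ?thesis by (intro exI[of _ "{}"] conjI) auto
next
  case False
  have npos: "n > 0" using n(2) by simp
  define X1 where "X1 = {x \<in> X. real (rdeg r Y x) \<ge> \<epsilon> / 2 * n}"
  have X1: "X1 \<subseteq> X" "finite X1" using fin by (auto simp: X1_def)
  have "real (pairs r X Y) = real (pairs r X1 Y) + real (pairs r (X - X1) Y)"
    using pairs_Un_left[of X1 "X - X1" r Y] X1 fin by (simp add: Un_absorb1)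
  moreover have "real (pairs r X1 Y) \<le> real (card X1) * n"
    using X1 fin card rdeg_le_card[of Y r] by (intro pairs_le) (auto intro: order_trans)
  moreover have "real (pairs r (X - X1) Y) \<le> real (card (X - X1)) * (\<epsilon> / 2 * n)"
    using fin by (intro pairs_le) (auto simp: X1_def)
  moreover have "real (card (X - X1)) * (\<epsilon> / 2 * n) \<le> real n * (\<epsilon> / 2 * n)"
    using card eps card_mono[of X "X - X1"] fin by (intro mult_right_mono) auto
  \<comment> \<open>Elements outside \<open>X1\<close> account for at most half of the \<epsilon>n^2
    pairs, and each element of \<open>X1\<close> for at most \<open>n\<close>.\<close>
  ultimately have "\<epsilon> * real n ^ 2 \<le> real (card X1) * n + real n * (\<epsilon> / 2 * n)"
    using dense by linarith
  then have "real n * (\<epsilon> / 2 * n) \<le> real n * real (card X1)"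
    by (simp add: power2_eq_square field_simps)
  then have "\<epsilon> / 2 * n \<le> real (card X1)" using npos by (simp only: mult_le_cancel_left_pos of_nat_0_less_iff)
  then have "K \<le> card X1" using n(1) by (simp add: field_simps)
  then obtain X0 where X0: "X0 \<subseteq> X1" "card X0 = K" "finite X0"
    by (meson X1(2) obtain_subset_with_card_n)
  have "real (card X0) * (\<epsilon> / 2 * n) \<le> real (pairs r X0 Y)"
    using X0 by (intro pairs_ge) (auto simp: X1_def)
  moreover have "2 * real s * n \<le> real (card X0) * (\<epsilon> / 2 * n)"
    using mult_right_mono[OF K, of "real n / 2"] X0(2) by (simp add: field_simps)
  ultimately have A: "2 * real s * n \<le> real (pairs (\<lambda>y x. r x y) Y X0)"
    using pairs_swap[of X0 Y r] X0 fin by simp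
  define Y1 where "Y1 = {y \<in> Y. rdeg (\<lambda>y x. r x y) X0 y \<ge> s}"
  have Y1: "Y1 \<subseteq> Y" "finite Y1" using fin by (auto simp: Y1_def)
  have "real (pairs (\<lambda>y x. r x y) Y X0) = real (pairs (\<lambda>y x. r x y) Y1 X0) + real (pairs (\<lambda>y x. r x y) (Y - Y1) X0)"
    using pairs_Un_left[of Y1 "Y - Y1" _ X0] Y1 fin by (simp add: Un_absorb1)
  moreover have "real (pairs (\<lambda>y x. r x y) Y1 X0) \<le> real (card Y1) * K"
    using Y1 X0 rdeg_le_card[of X0] by (intro pairs_le) auto
  moreover have "real (pairs (\<lambda>y x. r x y) (Y - Y1) X0) \<le> real (card (Y - Y1)) * s"
    using fin by (intro pairs_le) (auto simp: Y1_def)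
  moreover have "real (card (Y - Y1)) * s \<le> real n * s"
    using card card_mono[of Y "Y - Y1"] fin by (intro mult_right_mono) auto
  ultimately have "real s * n \<le> real (card Y1) * K"
    using A by (simp add: algebra_simps)
  then have sn: "s * n \<le> card Y1 * K" by (metis of_nat_le_iff of_nat_mult)
  \<comment> \<open>If fewer than \<open>s\<close> elements of \<open>Y1\<close> had each given
    trace on \<open>X0\<close>, then \<open>sn\<close> would contradict
    \<open>n > 2 ^ K * K\<close>.\<close>
  have "\<exists>S\<in>Pow X0. card {y \<in> Y1. {x \<in> X0. r x y} = S} \<ge> s"
  proof (rule ccontr)
    assume neg: "\<not> ?thesis"
    have small: "card {y \<in> Y1. {x \<in> X0. r x y} = S} \<le> s" if "S \<in> Pow X0" for S
      using neg that by (auto simp: not_le intro: less_imp_le)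
    have "Y1 \<subseteq> (\<Union>S\<in>Pow X0. {y \<in> Y1. {x \<in> X0. r x y} = S})"
    proof
      fix y assume "y \<in> Y1"
      then show "y \<in> (\<Union>S\<in>Pow X0. {y \<in> Y1. {x \<in> X0. r x y} = S})"
        by (intro UN_I[of "{x \<in> X0. r x y}"]) (simp_all add: Collect_restrict)
    qed
    then have "card Y1 \<le> card (\<Union>S\<in>Pow X0. {y \<in> Y1. {x \<in> X0. r x y} = S})"
      using X0(3) Y1(2) by (intro card_mono finite_UN_I) simp_all
    also have "\<dots> \<le> (\<Sum>S\<in>Pow X0. card {y \<in> Y1. {x \<in> X0. r x y} = S})"
      using X0(3) by (intro card_UN_le) simp
    also have "\<dots> \<le> of_nat (card (Pow X0)) * s" by (rule sum_bounded_above) (rule small)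
    also have "\<dots> = 2 ^ K * s" using X0 by (simp add: card_Pow)
    finally have "card Y1 * K \<le> 2 ^ K * s * K" by simp
    from order_trans[OF sn this] have "s * n \<le> s * (2 ^ K * K)" by (simp only: mult_ac)
    then show False using False n(2) by simp
  qed
  then obtain S where S: "S \<subseteq> X0" "card {y \<in> Y1. {x \<in> X0. r x y} = S} \<ge> s" by auto
  \<comment> \<open>Since \<open>s\<close> is positive the class has a member, and membership in
    \<open>Y1\<close> forces its trace \<open>S\<close> to have at least \<open>s\<close>
    elements.\<close>
  then obtain y where "y \<in> Y1" "{x \<in> X0. r x y} = S"
    using False card_gt_0_iff[of "{y \<in> Y1. {x \<in> X0. r x y} = S}"] by auto
  then have "s \<le> card S" by (auto simp: Y1_def rdeg_def)
  then obtain S' where S': "S' \<subseteq> S" "card S' = s" by (meson obtain_subset_with_card_n)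
  obtain R where R: "R \<subseteq> {y \<in> Y1. {x \<in> X0. r x y} = S}" "card R = s"
    using S(2) by (meson obtain_subset_with_card_n)
  have "\<forall>x\<in>S'. \<forall>y\<in>R. r x y" using S' R(1) by blast
  then show ?thesis using S' R X0 X1 Y1 S(1) by (intro exI[of _ S'] conjI exI[of _ R]) auto
qed

text \<open>Union bound over the sets of non-neighbours of the elements of \<open>S\<close>.\<close>

lemma card_common_ge:
  assumes "finite S" "finite B" "\<And>a. a \<in> S \<Longrightarrow> real (rdeg (\<lambda>x y. \<not> r x y) B a) \<le> m"
  shows "real (card {b\<in>B. \<forall>a\<in>S. r a b}) \<ge> real (card B) - real (card S) * m"
proof -
  have "card (B - {b\<in>B. \<forall>a\<in>S. r a b}) \<le> card (\<Union>a\<in>S. {b\<in>B. \<not> r a b})"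
    using assms by (intro card_mono) auto
  also have "\<dots> \<le> pairs (\<lambda>x y. \<not> r x y) S B"
    unfolding pairs_def rdeg_def using assms by (intro card_UN_le)
  also have "real \<dots> \<le> real (card S) * m" using assms by (intro pairs_le)
  finally have "real (card (B - {b\<in>B. \<forall>a\<in>S. r a b})) \<le> real (card S) * m" by simp
  moreover have "card B = card (B - {b\<in>B. \<forall>a\<in>S. r a b}) + card {b\<in>B. \<forall>a\<in>S. r a b}"
    using assms(2) by (simp add: card_Diff_subset card_mono)
  ultimately show ?thesis by linarith
qed

section \<open>Maximum cuts of dense graphs with sparse neighbourhoods\<close>

text \<open>For a graph this is twice the number of edges that do not cross the cut, so maximum cuts
  are its minimisers.\<close>

definition inner_pairs :: "('a \<Rightarrow> 'a \<Rightarrow> bool) \<Rightarrow> 'a set \<Rightarrow> 'a set \<Rightarrow> nat" where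
  "inner_pairs r V A = pairs r A A + pairs r (V - A) (V - A)"

section \<open>Maximum cuts of graphs given by an adjacency predicate\<close>

locale sym_graph =
  fixes V :: "'a set" and adj :: "'a \<Rightarrow> 'a \<Rightarrow> bool"
  assumes finite_V: "finite V"
    and adj_sym: "adj x y \<Longrightarrow> adj y x"
    and adj_irrefl: "\<not> adj x x"
begin

lemma pairs_adj_swap: "finite X \<Longrightarrow> finite Y \<Longrightarrow> pairs adj X Y = pairs adj Y X"
proof -
  assume "finite X" "finite Y"
  moreover have "(\<lambda>y x. adj x y) = adj" using adj_sym by blast
  ultimately show ?thesis using pairs_swap[of X Y adj] by simp
qed

lemma pairs_V_split:
  assumes "A \<subseteq> V"
  shows "pairs adj V V = inner_pairs adj V A + 2 * pairs adj A (V - A)"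
proof -
  have fin: "finite A" "finite (V - A)" using assms finite_V finite_subset by auto
  have V: "V = A \<union> (V - A)" using assms by auto
  have "pairs adj V V = pairs adj (A \<union> (V - A)) (A \<union> (V - A))" using V by simp
  also have "\<dots> = pairs adj A A + pairs adj A (V - A) + (pairs adj (V - A) A + pairs adj (V - A) (V - A))"
    using fin by (simp add: pairs_Un_left pairs_Un_right del: Un_Diff_cancel)
  finally show ?thesis using pairs_adj_swap[of A "V - A"] fin by (simp add: inner_pairs_def)
qed

lemma inner_pairs_compl: "A \<subseteq> V \<Longrightarrow> inner_pairs adj V (V - A) = inner_pairs adj V A"
  by (simp add: inner_pairs_def double_diff)

text \<open>The neighbourhood of a vertex of maximum degree is one side of the partition.\<close>

lemma ex_partition_few_inner_pairs:
  assumes sparse: "\<And>x. x \<in> V \<Longrightarrow> real (pairs adj {y\<in>V. adj x y} {y\<in>V. adj x y}) \<le> d"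
    and dense: "real (pairs adj V V) \<ge> real (card V) ^ 2 / 2 - 2 * h" and "d \<ge> 0" "h \<ge> 0"
  shows "\<exists>A\<subseteq>V. real (inner_pairs adj V A) \<le> 2 * d + 2 * h"
proof (cases "V = {}")
  case True
  then show ?thesis using assms(3,4) by (intro exI[of _ "{}"]) (simp add: inner_pairs_def pairs_def)
next
  case False
  then obtain x where x: "x \<in> V" "\<forall>y\<in>V. rdeg adj V y \<le> rdeg adj V x"
    by (metis finite_V obtains_MAX Max_ge finite_imageI imageI)
  define A where "A = {y\<in>V. adj x y}"
  have A: "A \<subseteq> V" "finite A" using finite_V by (auto simp: A_def)
  have cA: "card A = rdeg adj V x" by (simp add: A_def rdeg_def)
  \<comment> \<open>No degree exceeds \<open>card A\<close>, so this degree sum is at most a product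
    of two numbers with sum \<open>card V\<close>.\<close>
  have "real (pairs adj (V - A) V) \<le> real (card (V - A)) * card A"
    using x finite_V cA by (intro pairs_le) auto
  also have "real (card (V - A)) * card A = (real (card V) - card A) * card A"
    using A finite_V by (simp add: card_Diff_subset of_nat_diff card_mono)
  also have "\<dots> \<le> real (card V) ^ 2 / 4"
    using zero_le_power2[of "real (card V) - 2 * card A"] by (simp add: power2_eq_square algebra_simps)
  finally have 1: "real (pairs adj (V - A) V) \<le> real (card V) ^ 2 / 4" .
  have "pairs adj (V - A) V = pairs adj (V - A) A + pairs adj (V - A) (V - A)"
    using pairs_Un_right[of A "V - A" adj "V - A"] A finite_V by (simp add: Un_absorb1[OF A(1)])
  then have 2: "real (pairs adj (V - A) V) = real (pairs adj A (V - A)) + real (pairs adj (V - A) (V - A))"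
    using pairs_adj_swap[of A "V - A"] A finite_V by simp
  have 3: "real (pairs adj V V) = real (pairs adj A A) + real (pairs adj (V - A) (V - A)) + 2 * real (pairs adj A (V - A))"
    using pairs_V_split[OF A(1)] by (simp add: inner_pairs_def)
  have "real (pairs adj A A) \<le> d" using sparse[OF x(1)] by (simp add: A_def)
  \<comment> \<open>Doubling \<open>1\<close> and comparing with \<open>3\<close> and
    \<open>dense\<close> leaves at most \<open>d + 2 * h\<close> pairs inside
    \<open>V - A\<close>.\<close>
  then show ?thesis using A 1 2 3 dense by (intro exI[of _ A]) (simp add: inner_pairs_def)
qed

text \<open>Moving \<open>t\<close> to the other side changes the count by twice the difference of
  its two degrees.\<close>

lemma max_cut_inner_degree:
  assumes "A \<subseteq> V" and min: "\<And>A'. A' \<subseteq> V \<Longrightarrow> inner_pairs adj V A \<le> inner_pairs adj V A'" and t: "t \<in> A"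
  shows "rdeg adj A t \<le> rdeg adj (V - A) t"
proof -
  have fin: "finite A" "finite (V - A)" using assms finite_V finite_subset by auto
  have A: "insert t (A - {t}) = A" using t by auto
  have "V - (A - {t}) = insert t (V - A)" using assms by auto
  then have "inner_pairs adj V (A - {t}) = pairs adj (A - {t}) (A - {t}) + pairs adj (V - A) (V - A) + 2 * rdeg adj (V - A) t"
    using pairs_insert_self[of "V - A" t adj] fin t adj_sym adj_irrefl by (simp add: inner_pairs_def)
  moreover have "pairs adj A A = pairs adj (A - {t}) (A - {t}) + 2 * rdeg adj (A - {t}) t"
    using pairs_insert_self[of "A - {t}" t adj] fin adj_sym adj_irrefl unfolding A by simp
  moreover have "rdeg adj (A - {t}) t = rdeg adj A t"
    using adj_irrefl[of t] unfolding rdeg_def by (intro arg_cong[of _ _ card]) auto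
  ultimately show ?thesis using min[of "A - {t}"] assms(1) by (auto simp: inner_pairs_def)
qed

text \<open>A neighbour of \<open>t\<close> in \<open>A\<close> and one in \<open>B\<close> either
  are adjacent, and then are counted in the sparse neighbourhood of \<open>t\<close>, or form a
  missing cross pair.\<close>

lemma inner_degree_bound:
  assumes AB: "A \<subseteq> V" "B \<subseteq> V" "t \<in> V" and le: "rdeg adj A t \<le> rdeg adj B t"
    and sparse: "\<And>x S R. x \<in> V \<Longrightarrow> S \<subseteq> {y\<in>V. adj x y} \<Longrightarrow> R \<subseteq> {y\<in>V. adj x y} \<Longrightarrow> real (pairs adj S R) \<le> d"
    and miss: "real (pairs (\<lambda>x y. \<not> adj x y) A B) \<le> m"
  shows "real (rdeg adj A t) ^ 2 \<le> d + m"
proof -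
  define S where "S = {y\<in>A. adj t y}"
  define R where "R = {y\<in>B. adj t y}"
  have fin: "finite A" "finite B" using AB finite_V finite_subset by auto
  have SR: "finite S" "finite R" "S \<subseteq> A" "R \<subseteq> B" using fin by (auto simp: S_def R_def)
  have "real (rdeg adj A t) ^ 2 \<le> real (card S) * real (card R)"
    using le by (auto simp: S_def R_def rdeg_def power2_eq_square intro!: mult_mono)
  also have "\<dots> = real (pairs adj S R) + real (pairs (\<lambda>x y. \<not> adj x y) S R)"
    using pairs_compl[of S R adj] SR by (metis of_nat_add of_nat_mult)
  also have "real (pairs adj S R) \<le> d"
    using AB by (intro sparse[of t]) (auto simp: S_def R_def)
  also have "real (pairs (\<lambda>x y. \<not> adj x y) S R) \<le> real (pairs (\<lambda>x y. \<not> adj x y) A B)"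
    using pairs_mono[of A B S R] fin SR by auto
  finally show ?thesis using miss by linarith
qed

text \<open>Together with \<open>x\<close>, any \<open>s\<close> of its neighbours in
  \<open>X\<close> would have \<open>s\<close> common neighbours in \<open>B\<close>, giving a
  K(s,s) in the neighbourhood of \<open>x\<close>. The separate bound \<open>m'\<close> can be 0
  when \<open>B\<close> consists of neighbours of \<open>x\<close>.\<close>

lemma kss_free_rdeg_less:
  assumes kfree: "\<not> (\<exists>x\<in>V. \<exists>S R. S \<subseteq> {y\<in>V. adj x y} \<and> R \<subseteq> {y\<in>V. adj x y} \<and>
      card S = s \<and> card R = s \<and> (\<forall>a\<in>S. \<forall>b\<in>R. adj a b))"
    and X: "X \<subseteq> V" and B: "B \<subseteq> V" and x: "x \<in> V"
    and miss: "real (rdeg (\<lambda>x y. \<not> adj x y) B x) \<le> m'"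
      "\<And>a. a \<in> X \<Longrightarrow> real (rdeg (\<lambda>x y. \<not> adj x y) B a) \<le> m"
    and large: "real (card B) \<ge> real s * m + m' + s"
  shows "rdeg adj X x < s"
proof (rule ccontr)
  assume "\<not> rdeg adj X x < s"
  then obtain S where S: "S \<subseteq> {y\<in>X. adj x y}" "card S = s" "finite S"
    unfolding rdeg_def by (meson not_le obtain_subset_with_card_n)
  define B' where "B' = {b\<in>B. adj x b}"
  have fin: "finite B" using B finite_V by (rule finite_subset)
  then have "finite B'" by (simp add: B'_def)
  have "real (card B') \<ge> real (card B) - m'"
    using rdeg_compl[OF fin, of adj x] miss(1) unfolding B'_def rdeg_def by linarith
  moreover have "real (card {b\<in>B'. \<forall>a\<in>S. adj a b}) \<ge> real (card B') - real (card S) * m"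
  proof (rule card_common_ge)
    fix a assume "a \<in> S"
    then have "real (rdeg (\<lambda>x y. \<not> adj x y) B a) \<le> m" using S miss(2) by auto
    then show "real (rdeg (\<lambda>x y. \<not> adj x y) B' a) \<le> m"
      using rdeg_mono[of B B' "\<lambda>x y. \<not> adj x y" a] fin by (auto simp: B'_def)
  qed (use \<open>finite B'\<close> S in auto)
  ultimately have "real s \<le> real (card {b\<in>B'. \<forall>a\<in>S. adj a b})" using large unfolding S(2) by linarith
  then obtain R where "R \<subseteq> {b\<in>B'. \<forall>a\<in>S. adj a b}" "card R = s"
    by (meson of_nat_le_iff obtain_subset_with_card_n)
  with S have "S \<subseteq> {y\<in>V. adj x y}" "R \<subseteq> {y\<in>V. adj x y}" "\<forall>a\<in>S. \<forall>b\<in>R. adj a b" "card R = s"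
    using X B by (auto simp: B'_def)
  with S(2) x kfree show False by blast
qed

text \<open>Inner pairs are charged to missing cross pairs. Degrees inside \<open>A - T\<close> are
  below \<open>s\<close>, and \<open>T\<close>, the set of vertices that miss many cross pairs, is
  so small that the pairs meeting it number at most half of the missing ones.\<close>

lemma pairs_inner_le:
  assumes kfree: "\<not> (\<exists>x\<in>V. \<exists>S R. S \<subseteq> {y\<in>V. adj x y} \<and> R \<subseteq> {y\<in>V. adj x y} \<and>
      card S = s \<and> card R = s \<and> (\<forall>a\<in>S. \<forall>b\<in>R. adj a b))"
    and A: "A \<subseteq> V" and B: "B \<subseteq> V" and cB: "real (card B) \<ge> 2 / 5 * n"
    and n: "real s \<le> n / 8" "n > 0"
    and inner: "\<And>t. t \<in> A \<Longrightarrow> real (rdeg adj A t) \<le> n / (32 * (real s + 1))"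
  shows "real (pairs adj A A) \<le> real (card A) * s + real (pairs (\<lambda>x y. \<not> adj x y) A B) / 2"
proof -
  \<comment> \<open>Below this threshold \<open>s + 1\<close> vertices miss at most
    \<open>n / 8\<close> vertices of \<open>B\<close> together, which leaves at least
    \<open>s\<close> of them. It is also four times the bound in \<open>inner\<close>.\<close>
  let ?c = "n / (8 * (real s + 1))"
  define T where "T = {x\<in>A. real (rdeg (\<lambda>x y. \<not> adj x y) B x) \<ge> ?c}"
  define X where "X = A - T"
  have fin: "finite A" "finite B" using A B finite_V finite_subset by auto
  have T: "T \<subseteq> A" "finite T" "finite X" "X \<subseteq> A" using fin by (auto simp: T_def X_def)
  have "real (card T) * ?c \<le> real (pairs (\<lambda>x y. \<not> adj x y) A B)"
    unfolding T_def using fin by (rule card_large_rdeg)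
  then have cT: "real (card T) * (n / (32 * (real s + 1))) \<le> real (pairs (\<lambda>x y. \<not> adj x y) A B) / 4"
    by (simp add: field_simps)
  have "real (rdeg adj X x) \<le> real s" if "x \<in> X" for x
  proof -
    have "rdeg adj X x < s"
    proof (rule kss_free_rdeg_less[OF kfree])
      have "k * (n / (8 * k)) = n / 8" if "k > 0" for k :: real using that by simp
      from this[of "real s + 1"] have "real s * ?c + ?c = n / 8" by (simp only: distrib_right mult_1_left)
      moreover have "real (card B) \<ge> n / 8 + s" using cB n by linarith
      ultimately show "real (card B) \<ge> real s * ?c + ?c + s" by (simp only:)
    qed (use that T A B in \<open>auto simp: X_def T_def\<close>)
    then show ?thesis by simp
  qed
  then have "real (pairs adj X X) \<le> real (card X) * s" using T by (intro pairs_le) auto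
  also have "\<dots> \<le> real (card A) * s" using T fin by (intro mult_right_mono) (auto intro: card_mono)
  finally have XX: "real (pairs adj X X) \<le> real (card A) * s" .
  have "real (pairs adj T A) \<le> real (card T) * (n / (32 * (real s + 1)))"
    using T inner by (intro pairs_le) auto
  with cT have TA: "real (pairs adj T A) \<le> real (pairs (\<lambda>x y. \<not> adj x y) A B) / 4" by linarith
  have A: "A = X \<union> T" "X \<inter> T = {}" using T by (auto simp: X_def)
  have "pairs adj A A = pairs adj X A + pairs adj T A"
    using pairs_Un_left[of X T adj A] A T by simp
  also have "pairs adj X A = pairs adj X X + pairs adj T X"
    using pairs_Un_right[of X T adj X] A T pairs_adj_swap[of X T] by simp
  also have "pairs adj T X \<le> pairs adj T A" using fin T by (intro pairs_mono) auto
  finally have "real (pairs adj A A) \<le> real (pairs adj X X) + 2 * real (pairs adj T A)" by linarith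
  with XX TA show ?thesis by linarith
qed

text \<open>A bootstrap. Crude bounds of order \<theta>^2 n^2 on inner and missing pairs make the
  inner degrees small; this bounds the inner pairs by \<open>s * n\<close> plus the missing pairs,
  and the final bound no longer involves \<theta>.\<close>

lemma cut_structure:
  assumes kfree: "\<not> (\<exists>x\<in>V. \<exists>S R. S \<subseteq> {y\<in>V. adj x y} \<and> R \<subseteq> {y\<in>V. adj x y} \<and>
      card S = s \<and> card R = s \<and> (\<forall>a\<in>S. \<forall>b\<in>R. adj a b))"
    and sparse: "\<And>x S R. x \<in> V \<Longrightarrow> S \<subseteq> {y\<in>V. adj x y} \<Longrightarrow> R \<subseteq> {y\<in>V. adj x y} \<Longrightarrow> real (pairs adj S R) \<le> \<theta>\<^sup>2 * n\<^sup>2"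
    and dense: "real (pairs adj V V) \<ge> n\<^sup>2 / 2 - 2 * h"
    and n: "n = real (card V)" "real s \<le> n / 8" "n > 0"
    and h: "0 \<le> h" "h \<le> \<theta>\<^sup>2 * n\<^sup>2" and \<theta>: "\<theta> = 1 / (64 * (real s + 1))"
  shows "\<exists>A\<subseteq>V. real (card A) \<ge> 2 / 5 * n \<and> real (card (V - A)) \<ge> 2 / 5 * n \<and>
    real (pairs (\<lambda>x y. \<not> adj x y) A (V - A)) \<le> 2 * h + s * n"
proof -
  define e where "e = \<theta>\<^sup>2 * n\<^sup>2"
  obtain A0 where A0: "A0 \<subseteq> V" "real (inner_pairs adj V A0) \<le> 2 * e + 2 * h"
    using ex_partition_few_inner_pairs[of "\<theta>\<^sup>2 * n\<^sup>2" h] sparse dense h n by (auto simp: e_def)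
  have "\<exists>A. A \<subseteq> V \<and> (\<forall>A'. A' \<subseteq> V \<longrightarrow> inner_pairs adj V A \<le> inner_pairs adj V A')"
    using ex_has_least_nat[of "\<lambda>A. A \<subseteq> V" A0 "inner_pairs adj V"] A0 by blast
  then obtain A where A: "A \<subseteq> V" and min: "\<And>A'. A' \<subseteq> V \<Longrightarrow> inner_pairs adj V A \<le> inner_pairs adj V A'"
    by blast
  have inn: "real (inner_pairs adj V A) \<le> 4 * e" using A0 min[OF A0(1)] h by (simp add: e_def)
  define B where "B = V - A"
  have B: "B \<subseteq> V" "V - B = A" using A by (auto simp: B_def)
  have fin: "finite A" "finite B" using A B finite_V finite_subset by auto
  define a b where "a = real (card A)" and "b = real (card B)"
  have ab: "a + b = n" using A finite_V fin by (simp add: a_def b_def n B_def card_Diff_subset of_nat_diff card_mono)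
  define M where "M = real (pairs (\<lambda>x y. \<not> adj x y) A B)"
  have M: "real (pairs adj A B) = a * b - M"
    using pairs_compl[of A B adj] fin by (simp add: a_def b_def M_def flip: of_nat_mult of_nat_add)
  have neg_sym: "(\<lambda>y x. \<not> adj x y) = (\<lambda>x y. \<not> adj x y)" using adj_sym by blast
  have swapM: "real (pairs (\<lambda>x y. \<not> adj x y) B A) = M"
    using pairs_swap[of A B "\<lambda>x y. \<not> adj x y"] fin
    unfolding M_def by (simp add: neg_sym)
  have split: "real (pairs adj V V) = real (inner_pairs adj V A) + 2 * (a * b - M)"
    using pairs_V_split[OF A] M by (simp add: B_def)
  define D where "D = (a - b)\<^sup>2"
  have D: "D \<ge> 0" by (simp add: D_def)
  have sq: "a * b = n\<^sup>2 / 4 - D / 4" unfolding D_def ab[symmetric] by (simp add: power2_eq_square field_simps)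
  \<comment> \<open>The count in \<open>dense\<close> is measured against the balanced complete
    bipartite graph, so missing pairs and the imbalance \<open>D\<close> must both be paid for by
    \<open>h\<close> and the inner pairs.\<close>
  have main: "M + D / 4 \<le> h + real (inner_pairs adj V A) / 2"
  proof -
    have "real (pairs adj V V) = real (inner_pairs adj V A) + n\<^sup>2 / 2 - D / 2 - 2 * M"
      unfolding split sq by (simp add: field_simps)
    with dense show ?thesis by simp
  qed
  have M3: "M \<le> 3 * e" using main inn h D by (simp add: e_def)
  have "(a - b)\<^sup>2 \<le> 12 * e" using main inn h M_def unfolding e_def D_def[symmetric] by linarith
  also have "12 * e \<le> (n / 5)\<^sup>2"
  proof -
    have "\<theta> \<le> 1 / 64" "0 \<le> \<theta>" unfolding \<theta> by (auto simp: field_simps)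
    then have "\<theta>\<^sup>2 \<le> (1 / 64)\<^sup>2" by (intro power_mono)
    then have "e \<le> (1 / 64)\<^sup>2 * n\<^sup>2" unfolding e_def by (intro mult_right_mono) auto
    then show ?thesis by (simp add: power2_eq_square) (use zero_le_square[of n] in linarith)
  qed
  finally have "\<bar>a - b\<bar> \<le> n / 5" using abs_le_square_iff[of "a - b" "n / 5"] n by simp
  then have big: "a \<ge> 2 / 5 * n" "b \<ge> 2 / 5 * n" using ab by linarith+
  \<comment> \<open>Stated for any optimal cut because both \<open>A\<close> and its complement are
    needed. The value of \<theta> makes \<open>4 * e\<close> the square of the bound.\<close>
  have inner: "real (rdeg adj A t) \<le> n / (32 * (real s + 1))"
    if "A \<subseteq> V" "\<And>A'. A' \<subseteq> V \<Longrightarrow> inner_pairs adj V A \<le> inner_pairs adj V A'"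
      "real (pairs (\<lambda>x y. \<not> adj x y) A (V - A)) \<le> 3 * e" "t \<in> A" for t A
  proof -
    have "real (rdeg adj A t) ^ 2 \<le> e + 3 * e"
    proof (rule inner_degree_bound)
      show "rdeg adj A t \<le> rdeg adj (V - A) t" by (rule max_cut_inner_degree[OF that(1,2,4)])
      show "real (pairs adj S R) \<le> e" if "x \<in> V" "S \<subseteq> {y\<in>V. adj x y}" "R \<subseteq> {y\<in>V. adj x y}" for x S R
        unfolding e_def using that by (rule sparse)
    qed (use that(1,3,4) in auto)
    also have "\<dots> = (2 * \<theta> * n)\<^sup>2" by (simp add: e_def power2_eq_square)
    finally have "real (rdeg adj A t) \<le> 2 * \<theta> * n"
    proof (rule power2_le_imp_le)
      have "\<theta> \<ge> 0" by (simp add: \<theta>)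
      then show "0 \<le> 2 * \<theta> * n" using n(3) by simp
    qed
    also have "2 * \<theta> * n = n / (32 * (real s + 1))" unfolding \<theta> by (simp add: divide_simps)
    finally show ?thesis .
  qed
  have AA: "real (pairs adj A A) \<le> a * s + M / 2"
    unfolding a_def M_def
  proof (rule pairs_inner_le[OF kfree])
    show "real (rdeg adj A t) \<le> n / (32 * (real s + 1))" if "t \<in> A" for t
      using that A min M3 by (intro inner) (auto simp: M_def B_def)
  qed (use A B n big in \<open>auto simp: b_def\<close>)
  have BB: "real (pairs adj B B) \<le> b * s + M / 2"
    unfolding b_def swapM[symmetric]
  proof (rule pairs_inner_le[OF kfree])
    have "inner_pairs adj V B = inner_pairs adj V A" using inner_pairs_compl[OF A] by (simp add: B_def)
    then show "real (rdeg adj B t) \<le> n / (32 * (real s + 1))" if "t \<in> B" for t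
      using that B min M3 swapM by (intro inner) auto
  qed (use A B n big in \<open>auto simp: a_def\<close>)
  have "real (inner_pairs adj V A) \<le> s * n + M"
    using AA BB ab[symmetric] by (simp add: inner_pairs_def B_def algebra_simps)
  \<comment> \<open>In \<open>main\<close> the inner pairs are halved, so their term
    \<open>M\<close> is absorbed by the left-hand side.\<close>
  then have "M \<le> 2 * h + s * n" using main D by linarith
  then show ?thesis using A big by (intro exI[of _ A]) (simp add: a_def b_def M_def B_def)
qed

end

section \<open>Partial copies and re-embedding\<close>

text \<open>The domain \<open>D\<close> allows a piece of a copy to be treated by itself; with the
  host relation as a parameter, adding an edge only changes the relation.\<close>

definition partial_copy ::
  "('v \<Rightarrow> 'v \<Rightarrow> bool) \<Rightarrow> ('a \<Rightarrow> 'a \<Rightarrow> bool) \<Rightarrow> 'v set \<Rightarrow> 'a set \<Rightarrow> ('v \<Rightarrow> 'a) \<Rightarrow> bool" where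
  "partial_copy r adj D Y \<psi> \<longleftrightarrow>
     inj_on \<psi> D \<and> \<psi> ` D \<subseteq> Y \<and> (\<forall>f\<in>D. \<forall>g\<in>D. r f g \<longrightarrow> adj (\<psi> f) (\<psi> g))"

lemma partial_copy_mono: "partial_copy r adj D Y \<psi> \<Longrightarrow> Y \<subseteq> Y' \<Longrightarrow> partial_copy r adj D Y' \<psi>"
  by (auto simp: partial_copy_def)

text \<open>This is the freedom needed to move a piece away from the rest of a copy and from a few
  non-neighbours; \<open>L\<close> will bound the number of vertices to be avoided.\<close>

definition robust :: "('v \<Rightarrow> 'v \<Rightarrow> bool) \<Rightarrow> ('a \<Rightarrow> 'a \<Rightarrow> bool) \<Rightarrow> 'a set \<Rightarrow> real \<Rightarrow> 'v set \<Rightarrow> bool" where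
  "robust r adj Y L D \<longleftrightarrow>
     (\<forall>W. finite W \<and> real (card W) \<le> L \<longrightarrow> (\<exists>\<psi>. partial_copy r adj D (Y - W) \<psi>))"

text \<open>A piece that is not robust has a blocking set of size at most \<open>L\<close>; for a
  robust piece the empty set is taken. A copy that avoids the union of all these sets avoids the
  blocking set of its own piece, so that piece is robust.\<close>

lemma ex_nonrobust_cover:
  fixes Y :: "'a set" and P :: "'v set"
  assumes "finite P" "L \<ge> 0"
  shows "\<exists>Z. finite Z \<and> real (card Z) \<le> 2 ^ card P * L \<and>
    (\<forall>D\<subseteq>P. \<forall>\<psi>. partial_copy r adj D (Y - Z) \<psi> \<longrightarrow> robust r adj Y L D)"
proof -
  have "\<forall>D. \<exists>W. finite W \<and> real (card W) \<le> L \<and>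
      (\<forall>\<psi>. partial_copy r adj D (Y - W) \<psi> \<longrightarrow> robust r adj Y L D)"
    unfolding robust_def using assms(2) by (metis card.empty finite.emptyI of_nat_0)
  then obtain W where W: "\<And>D. finite (W D)" "\<And>D. real (card (W D)) \<le> L"
    "\<And>D \<psi>. partial_copy r adj D (Y - W D) \<psi> \<Longrightarrow> robust r adj Y L D" by metis
  define Z where "Z = (\<Union>D\<in>Pow P. W D)"
  have "real (card Z) \<le> (\<Sum>D\<in>Pow P. real (card (W D)))"
    using card_UN_le[of "Pow P" W] assms(1) unfolding Z_def by (simp flip: of_nat_sum)
  also have "\<dots> \<le> real (card (Pow P)) * L" using W(2) by (intro sum_bounded_above) auto
  also have "\<dots> = 2 ^ card P * L" using assms(1) by (simp add: card_Pow)
  finally have "real (card Z) \<le> 2 ^ card P * L" .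
  moreover have "finite Z" using assms(1) W(1) by (simp add: Z_def)
  moreover have "robust r adj Y L D" if "D \<subseteq> P" "partial_copy r adj D (Y - Z) \<psi>" for D \<psi>
    using partial_copy_mono[OF that(2), of "Y - W D"] that(1) by (intro W(3)) (auto simp: Z_def)
  ultimately show ?thesis by blast
qed

section \<open>Moving one side of a copy that a new edge creates\<close>

context sym_graph
begin

text \<open>For \<open>S\<close> inside \<open>X\<close>, \<open>(grow X ^^ j) S\<close> is the ball
  of radius \<open>j\<close> around \<open>S\<close> in the graph induced on
  \<open>X\<close>.\<close>

definition grow :: "'a set \<Rightarrow> 'a set \<Rightarrow> 'a set" where
  "grow X S = S \<union> {a\<in>X. \<exists>b\<in>S. adj a b}"

lemma grow_incr: "i \<le> j \<Longrightarrow> (grow X ^^ i) S \<subseteq> (grow X ^^ j) S"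
  by (rule lift_Suc_mono_le[of "\<lambda>i. (grow X ^^ i) S"]) (auto simp: grow_def)

text \<open>Inner degrees are bounded, so deleting a ball of fixed radius costs only a constant
  factor more than deleting its centre.\<close>

lemma card_grow_le:
  assumes "finite X" "\<And>x. x \<in> X \<Longrightarrow> rdeg adj X x \<le> s" "S \<subseteq> X"
  shows "(grow X ^^ j) S \<subseteq> X \<and> card ((grow X ^^ j) S) \<le> (s + 1) ^ j * card S"
proof (induction j)
  case 0
  then show ?case using assms(3) by simp
next
  case (Suc j)
  define R where "R = (grow X ^^ j) S"
  have R: "R \<subseteq> X" "finite R" using Suc assms(1) finite_subset by (auto simp: R_def)
  have "{a\<in>X. \<exists>b\<in>R. adj a b} = (\<Union>b\<in>R. {a\<in>X. adj b a})" using adj_sym by blast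
  then have "card (grow X R) \<le> card R + card (\<Union>b\<in>R. {a\<in>X. adj b a})"
    unfolding grow_def using card_Un_le by metis
  also have "card (\<Union>b\<in>R. {a\<in>X. adj b a}) \<le> (\<Sum>b\<in>R. card {a\<in>X. adj b a})"
    using R by (intro card_UN_le)
  also have "\<dots> \<le> of_nat (card R) * s"
    by (rule sum_bounded_above) (use assms(2) R in \<open>auto simp: rdeg_def\<close>)
  finally have "card (grow X R) \<le> (s + 1) * card R" by (simp add: mult.commute)
  also have "\<dots> \<le> (s + 1) * ((s + 1) ^ j * card S)"
    using Suc by (intro mult_left_mono) (auto simp: R_def)
  finally have "card (grow X R) \<le> (s + 1) ^ Suc j * card S" by (simp add: mult_ac)
  moreover have "grow X R \<subseteq> X" using R by (auto simp: grow_def)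
  moreover have "(grow X ^^ Suc j) S = grow X R" by (simp add: R_def)
  ultimately show ?case by simp
qed

text \<open>
  The copy \<open>\<phi>\<close> uses the new edge \<open>uv\<close>. By pigeonhole the growing sets stabilise on
  the copy at some stage \<open>j\<close>, so the part of the copy in \<open>Y\<close> outside stage \<open>j\<close> is joined
  only to itself and to the part in \<open>X\<close>; it contains \<open>v\<close> and can be moved elsewhere.
\<close>

lemma reembed_copy:
  fixes P :: "'v set"
  assumes copy: "partial_copy r (\<lambda>x y. adj x y \<or> {x, y} = {u, v}) P V \<phi>"
    and P: "finite P" "w \<in> P" "\<And>f. f \<in> P \<Longrightarrow> f \<noteq> w \<Longrightarrow> r w f" "\<And>f g. r f g \<Longrightarrow> r g f"
    and V: "V = X \<union> Y \<union> T" "X \<inter> Y = {}" "X \<inter> T = {}" "Y \<inter> T = {}"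
    and uv: "u \<in> X" "v \<in> Y" and w: "\<phi> w \<in> X"
    and T: "T \<subseteq> TA \<union> TB"
    and ZA: "\<And>x. x \<in> X \<Longrightarrow> real (rdeg (\<lambda>x y. \<not> adj x y) Y x) > q \<Longrightarrow> x \<in> ZA"
      "\<And>x t. x \<in> X \<Longrightarrow> t \<in> TB \<Longrightarrow> adj x t \<Longrightarrow> x \<in> ZA"
    and ZB: "\<And>y t. y \<in> Y \<Longrightarrow> t \<in> TA \<Longrightarrow> adj y t \<Longrightarrow> y \<in> ZB"
    and u: "u \<notin> (grow X ^^ 2) ZA" and v: "v \<notin> (grow Y ^^ card P) ZB"
    and q: "q \<ge> 0" "L \<ge> real (card P) * q + card P"
    and rob: "\<And>D \<psi>. D \<subseteq> P \<Longrightarrow> partial_copy r adj D (Y - ZB) \<psi> \<Longrightarrow> robust r adj Y L D"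
  shows "\<exists>\<psi>. partial_copy r adj P V \<psi>"
proof (cases "u \<in> \<phi> ` P \<and> v \<in> \<phi> ` P")
  case False
  \<comment> \<open>A copy that misses \<open>u\<close> or \<open>v\<close> does not use the new
    edge.\<close>
  then have "{\<phi> f, \<phi> g} \<noteq> {u, v}" if "f \<in> P" "g \<in> P" for f g
    using that by (metis doubleton_eq_iff imageI)
  then show ?thesis using copy by (intro exI[of _ \<phi>]) (auto simp: partial_copy_def)
next
  case True
  have fin: "finite X" "finite Y" "finite T" using finite_V V(1) by auto
  have inj: "inj_on \<phi> P" and sub: "\<phi> ` P \<subseteq> V"
    and edge: "\<And>f g. f \<in> P \<Longrightarrow> g \<in> P \<Longrightarrow> r f g \<Longrightarrow> adj (\<phi> f) (\<phi> g) \<or> {\<phi> f, \<phi> g} = {u, v}"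
    using copy by (auto simp: partial_copy_def)
  define Z where "Z j = (grow Y ^^ j) ZB" for j
  define K where "K = \<phi> ` P"
  have K: "finite K" "card K = card P" using P(1) inj by (auto simp: K_def card_image)
  have vK: "v \<in> K" using True by (simp add: K_def)
  have Z_Suc: "Z (Suc j) = Z j \<union> {a\<in>Y. \<exists>b\<in>Z j. adj a b}" for j by (simp add: Z_def grow_def)
  \<comment> \<open>If every stage captured a further vertex of \<open>K\<close>, stage
    \<open>card P\<close> would contain all of \<open>K\<close>, in particular
    \<open>v\<close>.\<close>
  have "\<exists>j<card P. K \<inter> Z (Suc j) \<subseteq> Z j"
  proof (rule ccontr)
    assume neg: "\<not> ?thesis"
    have "j \<le> card P \<Longrightarrow> j \<le> card (K \<inter> Z j)" for j
    proof (induction j)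
      case (Suc j)
      then have "\<not> K \<inter> Z (Suc j) \<subseteq> Z j" using neg by auto
      then have "K \<inter> Z j \<subset> K \<inter> Z (Suc j)" unfolding Z_Suc by blast
      then have "card (K \<inter> Z j) < card (K \<inter> Z (Suc j))" using K by (intro psubset_card_mono) auto
      then show ?case using Suc by auto
    qed simp
    then have "card K \<le> card (K \<inter> Z (card P))" using K by simp
    then have "K \<inter> Z (card P) = K" using K by (intro card_seteq) auto
    then show False using vK v by (auto simp: Z_def)
  qed
  then obtain j where j: "j < card P" "K \<inter> Z (Suc j) \<subseteq> Z j" by blast
  have ZBj: "ZB \<subseteq> Z j" using grow_incr[of 0 j Y ZB] by (simp add: Z_def)
  have vj: "v \<notin> Z j" using grow_incr[of j "card P" Y ZB] j(1) v by (auto simp: Z_def)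
  define D where "D = {f\<in>P. \<phi> f \<in> Y - Z j}"
  have D: "D \<subseteq> P" by (auto simp: D_def)
  \<comment> \<open>The piece avoids \<open>u\<close>, which lies in \<open>X\<close>, so none of
    its edges is the new one.\<close>
  have "partial_copy r adj D (Y - ZB) \<phi>"
    unfolding partial_copy_def
  proof (intro conjI ballI impI)
    show "inj_on \<phi> D" using inj D by (rule inj_on_subset)
    show "\<phi> ` D \<subseteq> Y - ZB" using ZBj by (auto simp: D_def)
    fix f g assume fg: "f \<in> D" "g \<in> D" "r f g"
    then have "\<phi> f \<noteq> u" "\<phi> g \<noteq> u" using uv V by (auto simp: D_def)
    then show "adj (\<phi> f) (\<phi> g)" using edge[of f g] fg D by (auto simp: doubleton_eq_iff)
  qed
  then have rob': "robust r adj Y L D" by (rule rob[OF D])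
  define N where "N x = {y\<in>Y. \<not> adj x y}" for x
  \<comment> \<open>The new position must avoid the old copy, for injectivity, and the
    non-neighbours of the copy's vertices in \<open>X\<close>. These vertices will be shown to lie
    outside \<open>ZA\<close>, so each excludes at most \<open>q\<close> positions.\<close>
  define W where "W = K \<union> (\<Union>x\<in>K \<inter> X - ZA. N x)"
  have finW: "finite W" using K fin by (auto simp: W_def N_def)
  have "real (card (N x)) \<le> q" if "x \<in> K \<inter> X - ZA" for x
    using ZA(1)[of x] that by (fastforce simp: N_def rdeg_def)
  then have "(\<Sum>x\<in>K \<inter> X - ZA. real (card (N x))) \<le> of_nat (card (K \<inter> X - ZA)) * q"
    by (rule sum_bounded_above)
  also have "\<dots> \<le> of_nat (card K) * q"
  proof (rule mult_right_mono)
    have "card (K \<inter> X - ZA) \<le> card K" by (rule card_mono) (use K in auto)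
    then show "real (card (K \<inter> X - ZA)) \<le> real (card K)" by simp
  qed (fact q)
  finally have "real (card (\<Union>x\<in>K \<inter> X - ZA. N x)) \<le> real (card P) * q"
    using card_UN_le[of "K \<inter> X - ZA" N] K by (simp flip: of_nat_sum)
  then have "real (card W) \<le> L"
    using card_Un_le[of K "\<Union>x\<in>K \<inter> X - ZA. N x"] K q unfolding W_def by linarith
  then obtain \<psi> where \<psi>: "partial_copy r adj D (Y - W) \<psi>"
    using rob' finW by (auto simp: robust_def)
  \<comment> \<open>The apex is within distance 1 of \<open>u\<close>, and every vertex of the copy
    in \<open>X\<close> is within distance 1 of the apex. As \<open>u\<close> is outside the ball of
    radius 2 around \<open>ZA\<close>, no vertex of the copy is in \<open>ZA\<close>.\<close>
  have near_w: "\<phi> w = u \<or> adj (\<phi> w) u"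
  proof -
    obtain f where f: "f \<in> P" "u = \<phi> f" using True by auto
    show ?thesis
    proof (cases "f = w")
      case False
      then have "adj (\<phi> w) u \<or> {\<phi> w, u} = {u, v}" using edge[of w f] P(2,3) f by auto
      then show ?thesis using w uv V by (auto simp: doubleton_eq_iff)
    qed (use f in simp)
  qed
  have grow2: "(grow X ^^ 2) ZA = grow X (grow X ZA)" by (simp add: numeral_2_eq_2)
  have w1: "\<phi> w \<notin> grow X ZA"
    using near_w u uv unfolding grow2 by (auto simp: grow_def intro: adj_sym)
  have in_X: "\<phi> g \<notin> ZA" if "g \<in> P" "\<phi> g \<in> X" for g
  proof (cases "g = w")
    case False
    then have "adj (\<phi> w) (\<phi> g) \<or> {\<phi> w, \<phi> g} = {u, v}" using edge[of w g] P(2,3) that by auto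
    then have "adj (\<phi> w) (\<phi> g)" using w that uv V by (auto simp: doubleton_eq_iff)
    then show ?thesis using w1 w by (auto simp: grow_def)
  qed (use w1 in \<open>auto simp: grow_def\<close>)
  \<comment> \<open>A vertex of the copy in \<open>TB\<close> would be adjacent to the apex and so
    put the apex into \<open>ZA\<close>.\<close>
  have in_T: "\<phi> g \<in> TA" if "g \<in> P" "\<phi> g \<in> T" for g
  proof -
    have "g \<noteq> w" using that w V by auto
    then have "adj (\<phi> w) (\<phi> g) \<or> {\<phi> w, \<phi> g} = {u, v}" using edge[of w g] P(2,3) that by auto
    then have "adj (\<phi> w) (\<phi> g)" using w that uv V by (auto simp: doubleton_eq_iff)
    then show ?thesis using ZA(2)[of "\<phi> w" "\<phi> g"] w w1 T that by (auto simp: grow_def)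
  qed
  \<comment> \<open>Outside itself the piece is joined to nothing in \<open>Y\<close>, by the choice
    of \<open>j\<close>, and to nothing in \<open>T\<close>, since neighbours of \<open>TA\<close>
    lie in \<open>ZB\<close>. What remains is in \<open>X\<close> and is handled by
    \<open>W\<close>.\<close>
  have cross: "adj (\<psi> f) (\<phi> g)" if f: "f \<in> D" and g: "g \<in> P - D" and r: "r f g" for f g
  proof -
    have fY: "\<phi> f \<in> Y" "\<phi> f \<notin> Z j" "\<phi> f \<in> K" using f by (auto simp: D_def K_def)
    have e: "adj (\<phi> f) (\<phi> g)" if "\<phi> g \<notin> X"
      using edge[of f g] f g r D that uv fY V by (auto simp: doubleton_eq_iff)
    have "\<phi> g \<notin> Y"
    proof
      assume gY: "\<phi> g \<in> Y"
      then have "\<phi> g \<in> Z j" using g by (auto simp: D_def)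
      moreover have "adj (\<phi> f) (\<phi> g)" using gY V by (intro e) auto
      ultimately have "\<phi> f \<in> Z (Suc j)" using Z_Suc[of j] fY by auto
      then show False using j fY by auto
    qed
    moreover have "\<phi> g \<notin> T"
    proof
      assume gT: "\<phi> g \<in> T"
      then have "adj (\<phi> f) (\<phi> g)" using V by (intro e) auto
      then have "\<phi> f \<in> ZB" using ZB in_T[of g] g gT fY by auto
      then show False using ZBj fY by auto
    qed
    ultimately have gX: "\<phi> g \<in> X" using sub g V by auto
    then have "\<phi> g \<in> K \<inter> X - ZA" using in_X g by (auto simp: K_def)
    moreover have "\<psi> f \<in> Y - W" using \<psi> f by (auto simp: partial_copy_def)
    ultimately have "adj (\<phi> g) (\<psi> f)" by (auto simp: W_def N_def)
    then show ?thesis by (rule adj_sym)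
  qed
  define \<chi> where "\<chi> f = (if f \<in> D then \<psi> f else \<phi> f)" for f
  have "partial_copy r adj P V \<chi>"
    unfolding partial_copy_def
  proof (intro conjI ballI impI)
    have "inj_on \<psi> D" "\<psi> ` D \<inter> K = {}" using \<psi> by (auto simp: partial_copy_def W_def)
    then show "inj_on \<chi> P" using inj unfolding inj_on_def \<chi>_def K_def by (auto split: if_splits)
    show "\<chi> ` P \<subseteq> V" using \<psi> sub V by (auto simp: partial_copy_def \<chi>_def)
    fix f g assume fg: "f \<in> P" "g \<in> P" "r f g"
    show "adj (\<chi> f) (\<chi> g)"
    proof (cases "f \<in> D"; cases "g \<in> D")
      assume "f \<in> D" "g \<in> D"
      then show ?thesis using \<psi> fg by (auto simp: partial_copy_def \<chi>_def)
    next
      assume "f \<in> D" "g \<notin> D"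
      then show ?thesis using cross fg by (auto simp: \<chi>_def)
    next
      assume "f \<notin> D" "g \<in> D"
      then show ?thesis using cross[of g f] fg P(4) adj_sym by (auto simp: \<chi>_def)
    next
      assume nD: "f \<notin> D" "g \<notin> D"
      \<comment> \<open>The vertex mapped to \<open>v\<close> belongs to \<open>D\<close>, so an
        edge with both ends outside \<open>D\<close> is not the new one.\<close>
      obtain h where h: "h \<in> P" "\<phi> h = v" using True by auto
      then have "h \<in> D" using uv vj by (auto simp: D_def)
      then have "\<phi> f \<noteq> v" "\<phi> g \<noteq> v" using h inj fg nD by (metis inj_onD)+
      then show ?thesis using edge[of f g] fg nD by (auto simp: \<chi>_def doubleton_eq_iff)
    qed
  qed
  then show ?thesis by blast
qed

section \<open>Deleting the exceptional vertices\<close>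

lemma card_neighbours_of_le:
  assumes "finite TT" "\<And>t. t \<in> TT \<Longrightarrow> real (rdeg adj X t) \<le> d" "finite X"
  shows "real (card {x\<in>X. \<exists>t\<in>TT. adj x t}) \<le> real (card TT) * d"
proof -
  have "{x\<in>X. \<exists>t\<in>TT. adj x t} = (\<Union>t\<in>TT. {x\<in>X. adj t x})" using adj_sym by blast
  then have "card {x\<in>X. \<exists>t\<in>TT. adj x t} \<le> (\<Sum>t\<in>TT. card {x\<in>X. adj t x})"
    using assms(1) by (simp add: card_UN_le)
  then have "real (card {x\<in>X. \<exists>t\<in>TT. adj x t}) \<le> (\<Sum>t\<in>TT. real (card {x\<in>X. adj t x}))"
    by (simp flip: of_nat_sum)
  also have "\<dots> \<le> real (card TT) * d" using assms(2) by (intro sum_bounded_above) (simp add: rdeg_def)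
  finally show ?thesis .
qed

text \<open>The loss consists of \<open>T\<close>, of size at most \<tau>, and in each part a ball
  around a set of size at most \<zeta>. The terms of \<zeta> stand for vertices missing more than
  \<open>q\<close> cross pairs, neighbours of \<open>T\<close>, and blocking sets of non-robust
  pieces. Later \<open>q\<close> is the square root of \<open>n\<close>.\<close>

lemma ex_large_complete_pair:
  fixes P :: "'v set"
  assumes kfree: "\<not> (\<exists>x\<in>V. \<exists>S R. S \<subseteq> {y\<in>V. adj x y} \<and> R \<subseteq> {y\<in>V. adj x y} \<and>
      card S = k \<and> card R = k \<and> (\<forall>a\<in>S. \<forall>b\<in>R. adj a b))"
    and AB: "A \<union> B = V" "A \<inter> B = {}" "real (card A) \<ge> 2 / 5 * n" "real (card B) \<ge> 2 / 5 * n"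
    and n: "n = real (card V)" "n > 0" "real k \<le> n / 8"
    and miss: "real (pairs (\<lambda>x y. \<not> adj x y) A B) \<le> \<mu>"
    and P: "finite P" "w \<in> P" "\<And>f. f \<in> P \<Longrightarrow> f \<noteq> w \<Longrightarrow> r w f" "\<And>f g. r f g \<Longrightarrow> r g f" "card P = k"
    and free: "\<nexists>\<psi>. partial_copy r adj P V \<psi>"
    and sat: "\<And>u v. u \<in> V \<Longrightarrow> v \<in> V \<Longrightarrow> u \<noteq> v \<Longrightarrow> \<not> adj u v \<Longrightarrow>
      \<exists>\<phi>. partial_copy r (\<lambda>x y. adj x y \<or> {x, y} = {u, v}) P V \<phi>"
    and q: "q > 0" and L: "L = real k * q + k"
    and \<tau>: "\<tau> = 16 * (real k + 1) * \<mu> / n"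
    and \<zeta>: "\<zeta> = \<mu> / q + \<tau> * L + 2 ^ k * L"
  shows "\<exists>A' B'. A' \<subseteq> A \<and> B' \<subseteq> B \<and> (\<forall>a\<in>A'. \<forall>b\<in>B'. adj a b) \<and>
    real (card A') + real (card B') \<ge> n - \<tau> - 2 * (real k + 1) ^ (k + 2) * \<zeta>"
proof -
  let ?nadj = "\<lambda>x y. \<not> adj x y"
  let ?c = "n / (8 * (real k + 1))"
  have fin: "finite A" "finite B" using AB finite_V by auto
  have neg_sym: "(\<lambda>y x. \<not> adj x y) = ?nadj" using adj_sym by blast
  have miss': "real (pairs ?nadj B A) \<le> \<mu>"
    using miss pairs_swap[OF fin, of ?nadj] unfolding neg_sym by simp
  have L0: "L \<ge> k" "L \<ge> 0" using q L by auto
  have \<mu>0: "\<mu> \<ge> 0" using miss by linarith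

  define TTA where "TTA = {a\<in>A. real (rdeg ?nadj B a) \<ge> ?c}"
  define TTB where "TTB = {b\<in>B. real (rdeg ?nadj A b) \<ge> ?c}"
  define T where "T = TTA \<union> TTB"
  define X where "X = A - T"
  define Y where "Y = B - T"
  have XY: "X \<subseteq> A" "Y \<subseteq> B" "finite X" "finite Y" "finite T" "T \<subseteq> V"
    using fin AB by (auto simp: X_def Y_def T_def TTA_def TTB_def)
  have V: "V = X \<union> Y \<union> T" "X \<inter> Y = {}" "X \<inter> T = {}" "Y \<inter> T = {}"
    using AB XY by (auto simp: X_def Y_def)
  have card_T_half: "real c \<le> \<tau> / 2" if "real c * ?c \<le> \<mu>" for c :: nat
    using that n(2) by (simp add: \<tau> field_simps)
  have "real (card TTA) \<le> \<tau> / 2"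
    unfolding TTA_def by (rule card_T_half, rule order_trans[OF card_large_rdeg miss]) (use fin in auto)
  moreover have "real (card TTB) \<le> \<tau> / 2"
    unfolding TTB_def by (rule card_T_half, rule order_trans[OF card_large_rdeg miss']) (use fin in auto)
  ultimately have cT: "real (card T) \<le> \<tau>" using card_Un_le[of TTA TTB] unfolding T_def by linarith

  have inner: "rdeg adj X x < k"
    if "X \<subseteq> V" "B \<subseteq> V" "x \<in> X" "\<And>x. x \<in> X \<Longrightarrow> real (rdeg ?nadj B x) < ?c" "real (card B) \<ge> 2 / 5 * n" for X B x
  proof (rule kss_free_rdeg_less[OF kfree])
    have "c * (n / (8 * c)) = n / 8" if "c > 0" for c :: real using that by simp
    from this[of "real k + 1"] have "real k * ?c + ?c = n / 8" by (simp only: distrib_right mult_1_left)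
    moreover have "real (card B) \<ge> n / 8 + k" using that n by linarith
    ultimately show "real (card B) \<ge> real k * ?c + ?c + k" by (simp only:)
  qed (use that in \<open>auto intro: less_imp_le\<close>)
  have innerX: "rdeg adj X x \<le> k" if "x \<in> X" for x
  proof (rule less_imp_le, rule inner[of X B])
    show "X \<subseteq> V" "B \<subseteq> V" using V AB by auto
  qed (use that AB in \<open>auto simp: X_def T_def TTA_def\<close>)
  have innerY: "rdeg adj Y y \<le> k" if "y \<in> Y" for y
  proof (rule less_imp_le, rule inner[of Y A])
    show "Y \<subseteq> V" "A \<subseteq> V" using V AB by auto
  qed (use that AB in \<open>auto simp: Y_def T_def TTB_def\<close>)

  define PX where "PX = {x\<in>X. real (rdeg ?nadj Y x) > q}"
  define PY where "PY = {y\<in>Y. real (rdeg ?nadj X y) > q}"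
  have cardP: "real (card {x\<in>X. real (rdeg ?nadj Y x) > q}) \<le> \<mu> / q"
    if "finite A" "finite B" "X \<subseteq> A" "Y \<subseteq> B" "real (pairs ?nadj A B) \<le> \<mu>" for A B X Y :: "'a set"
  proof -
    have finXY: "finite X" "finite Y" using that finite_subset by auto
    have "card {x\<in>X. real (rdeg ?nadj Y x) > q} \<le> card {x\<in>X. real (rdeg ?nadj Y x) \<ge> q}"
      using finXY by (intro card_mono) auto
    then have "real (card {x\<in>X. real (rdeg ?nadj Y x) > q}) * q \<le> real (card {x\<in>X. real (rdeg ?nadj Y x) \<ge> q}) * q"
      using q by (intro mult_right_mono) auto
    also have "\<dots> \<le> real (pairs ?nadj X Y)" using finXY by (intro card_large_rdeg)
    also have "\<dots> \<le> real (pairs ?nadj A B)" using that by (intro of_nat_mono pairs_mono)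
    finally show ?thesis using that(5) q by (simp add: field_simps)
  qed
  have cPX: "real (card PX) \<le> \<mu> / q" unfolding PX_def by (rule cardP[of A B]) (use fin XY miss in auto)
  have cPY: "real (card PY) \<le> \<mu> / q" unfolding PY_def by (rule cardP[of B A]) (use fin XY miss' in auto)

  \<comment> \<open>The \<open>k\<close> neighbours in \<open>X - PX\<close> of a vertex of
    \<open>TA\<close> miss at most \<open>k * q\<close> vertices of \<open>Y\<close>, so more than
    \<open>L\<close> neighbours in \<open>Y\<close> would give a K(k,k). Hence neighbours in
    \<open>Y\<close> are deleted for \<open>TA\<close>, and neighbours in \<open>X\<close> for
    \<open>TB\<close>.\<close>
  define TA where "TA = {t\<in>T. rdeg adj (X - PX) t \<ge> k}"
  define TB where "TB = T - TA"
  have TAB: "T = TA \<union> TB" "finite TA" "finite TB" using XY by (auto simp: TA_def TB_def)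
  have cTA: "real (card TA) \<le> \<tau>" "real (card TB) \<le> \<tau>"
    using card_mono[of T TA] card_mono[of T TB] TAB cT XY by auto
  have degTA: "real (rdeg adj Y t) \<le> L" if t: "t \<in> TA" for t
  proof (rule ccontr)
    assume "\<not> real (rdeg adj Y t) \<le> L"
    then have large: "real (card {y\<in>Y. adj t y}) \<ge> L" by (simp add: rdeg_def)
    have "rdeg adj (X - PX) t < k"
    proof (rule kss_free_rdeg_less[OF kfree])
      show "real (rdeg ?nadj {y\<in>Y. adj t y} t) \<le> 0" by (simp add: rdeg_def)
      show "real (rdeg ?nadj {y\<in>Y. adj t y} a) \<le> q" if "a \<in> X - PX" for a
        using that rdeg_mono[of Y "{y\<in>Y. adj t y}" ?nadj a] XY by (auto simp: PX_def)
      show "real (card {y\<in>Y. adj t y}) \<ge> real k * q + 0 + k" using large L by simp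
    qed (use V t XY in \<open>auto simp: TA_def\<close>)
    then show False using t by (auto simp: TA_def)
  qed
  have degTB: "real (rdeg adj (X - PX) t) \<le> L" if t: "t \<in> TB" for t
    using t L0 by (auto simp: TA_def TB_def)

  obtain WX where WX: "finite WX" "real (card WX) \<le> 2 ^ k * L"
    "\<And>D \<psi>. D \<subseteq> P \<Longrightarrow> partial_copy r adj D (X - WX) \<psi> \<Longrightarrow> robust r adj X L D"
    using ex_nonrobust_cover[OF P(1) L0(2), of r adj X] P(5) by auto
  obtain WY where WY: "finite WY" "real (card WY) \<le> 2 ^ k * L"
    "\<And>D \<psi>. D \<subseteq> P \<Longrightarrow> partial_copy r adj D (Y - WY) \<psi> \<Longrightarrow> robust r adj Y L D"
    using ex_nonrobust_cover[OF P(1) L0(2), of r adj Y] P(5) by auto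

  define ZX where "ZX = PX \<union> {x\<in>X. \<exists>t\<in>TB. adj x t} \<union> (WX \<inter> X)"
  define ZY where "ZY = PY \<union> {y\<in>Y. \<exists>t\<in>TA. adj y t} \<union> (WY \<inter> Y)"
  have ZX_sub: "ZX \<subseteq> X" "finite ZX" and ZY_sub: "ZY \<subseteq> Y" "finite ZY"
    using XY by (auto simp: ZX_def ZY_def PX_def PY_def)
  have mult_\<tau>: "real c * L \<le> \<tau> * L" if "real c \<le> \<tau>" for c :: nat
    using that L0 by (intro mult_right_mono)
  have card3: "real (card (U1 \<union> U2 \<union> U3)) \<le> \<zeta>"
    if "real (card U1) \<le> \<mu> / q" "real (card U2) \<le> \<tau> * L" "real (card U3) \<le> 2 ^ k * L" for U1 U2 U3 :: "'a set"
    using that card_Un_le[of "U1 \<union> U2" U3] card_Un_le[of U1 U2] unfolding \<zeta> by linarith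
  have cZX: "real (card ZX) \<le> \<zeta>"
  proof -
    \<comment> \<open>The degree bound for \<open>TB\<close> is available only outside
      \<open>PX\<close>, and \<open>PX\<close> is deleted anyway.\<close>
    have eq: "ZX = PX \<union> {x\<in>X - PX. \<exists>t\<in>TB. adj x t} \<union> (WX \<inter> X)" by (auto simp: ZX_def)
    have "real (card {x\<in>X - PX. \<exists>t\<in>TB. adj x t}) \<le> \<tau> * L"
      using card_neighbours_of_le[of TB "X - PX" L] TAB degTB XY mult_\<tau>[OF cTA(2)] by force
    moreover have "real (card (WX \<inter> X)) \<le> 2 ^ k * L"
      using WX(2) card_mono[of WX "WX \<inter> X"] WX(1) by force
    ultimately show ?thesis unfolding eq by (intro card3 cPX)
  qed
  have cZY: "real (card ZY) \<le> \<zeta>"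
  proof -
    have "real (card {y\<in>Y. \<exists>t\<in>TA. adj y t}) \<le> \<tau> * L"
      using card_neighbours_of_le[of TA Y L] TAB degTA XY mult_\<tau>[OF cTA(1)] by force
    moreover have "real (card (WY \<inter> Y)) \<le> 2 ^ k * L"
      using WY(2) card_mono[of WY "WY \<inter> Y"] WY(1) by force
    ultimately show ?thesis unfolding ZY_def by (intro card3 cPY)
  qed

  \<comment> \<open>\<open>reembed_copy\<close> asks for radius 2 on the side of the apex and radius
    \<open>k\<close> on the other; \<open>k + 2\<close> serves both orientations.\<close>
  define GX where "GX = (grow X ^^ (k + 2)) ZX"
  define GY where "GY = (grow Y ^^ (k + 2)) ZY"
  have GX: "GX \<subseteq> X" "card GX \<le> (k + 1) ^ (k + 2) * card ZX"
    using card_grow_le[OF XY(3) innerX ZX_sub(1), of "k + 2"] by (auto simp: GX_def)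
  have GY: "GY \<subseteq> Y" "card GY \<le> (k + 1) ^ (k + 2) * card ZY"
    using card_grow_le[OF XY(4) innerY ZY_sub(1), of "k + 2"] by (auto simp: GY_def)
  have bound: "real c \<le> (real k + 1) ^ (k + 2) * \<zeta>"
    if "c \<le> (k + 1) ^ (k + 2) * d" "real d \<le> \<zeta>" for c d :: nat
  proof -
    have "real c \<le> real ((k + 1) ^ (k + 2) * d)" using that(1) by (rule of_nat_mono)
    also have "\<dots> = (real k + 1) ^ (k + 2) * d" by (simp only: of_nat_mult of_nat_power of_nat_add of_nat_1)
    also have "\<dots> \<le> (real k + 1) ^ (k + 2) * \<zeta>" using that(2) by (intro mult_left_mono) auto
    finally show ?thesis .
  qed
  have cGX: "real (card GX) \<le> (real k + 1) ^ (k + 2) * \<zeta>" by (rule bound[OF GX(2) cZX])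
  have cGY: "real (card GY) \<le> (real k + 1) ^ (k + 2) * \<zeta>" by (rule bound[OF GY(2) cZY])

  have complete: "adj u v" if u: "u \<in> X - GX" and v: "v \<in> Y - GY" for u v
  proof (rule ccontr)
    assume nadj: "\<not> adj u v"
    have "u \<in> V" "v \<in> V" "u \<noteq> v" using u v V by auto
    then obtain \<phi> where \<phi>: "partial_copy r (\<lambda>x y. adj x y \<or> {x, y} = {u, v}) P V \<phi>"
      using sat nadj by blast
    have u': "u \<notin> (grow X ^^ j) ZX" and v': "v \<notin> (grow Y ^^ j) ZY" if "j \<le> k + 2" for j
      using u v grow_incr[OF that] by (auto simp: GX_def GY_def)
    have "\<phi> w \<in> V" using \<phi> P(2) by (auto simp: partial_copy_def)
    then consider "\<phi> w \<in> X" | "\<phi> w \<in> Y" | "\<phi> w \<in> T" using V by auto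
    then show False
    proof cases
      case 1
      have "\<exists>\<psi>. partial_copy r adj P V \<psi>"
      proof (rule reembed_copy[OF \<phi> P(1-4) V, where q = q and L = L and ZA = ZX and ZB = ZY and TA = TA and TB = TB])
        show "robust r adj Y L D" if "D \<subseteq> P" "partial_copy r adj D (Y - ZY) \<psi>" for D \<psi>
          using partial_copy_mono[OF that(2), of "Y - WY"] that(1) by (intro WY(3)) (auto simp: ZY_def)
      qed (use 1 u v u'[of 2] v'[of k] TAB q L P(5) in \<open>auto simp: ZX_def ZY_def PX_def\<close>)
      then show ?thesis using free by blast
    next
      \<comment> \<open>Mirror image of the first case: \<open>u\<close> and \<open>v\<close>,
        \<open>X\<close> and \<open>Y\<close>, \<open>TA\<close> and \<open>TB\<close> change
        places.\<close>
      case 2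
      have \<phi>': "partial_copy r (\<lambda>x y. adj x y \<or> {x, y} = {v, u}) P V \<phi>"
        using \<phi> by (simp add: insert_commute)
      have V': "V = Y \<union> X \<union> T" "Y \<inter> X = {}" "Y \<inter> T = {}" "X \<inter> T = {}" using V by auto
      have "\<exists>\<psi>. partial_copy r adj P V \<psi>"
      proof (rule reembed_copy[OF \<phi>' P(1-4) V', where q = q and L = L and ZA = ZY and ZB = ZX and TA = TB and TB = TA])
        show "robust r adj X L D" if "D \<subseteq> P" "partial_copy r adj D (X - ZX) \<psi>" for D \<psi>
          using partial_copy_mono[OF that(2), of "X - WX"] that(1) by (intro WX(3)) (auto simp: ZX_def)
      qed (use 2 u v u'[of k] v'[of 2] TAB q L P(5) in \<open>auto simp: ZX_def ZY_def PY_def\<close>)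
      then show ?thesis using free by blast
    next
      \<comment> \<open>The apex is neither \<open>u\<close> nor \<open>v\<close>, so it is adjacent
        to both in the old graph. If it lies in \<open>TA\<close> then \<open>v\<close> is in
        \<open>ZY\<close>, and if it lies in \<open>TB\<close> then \<open>u\<close> is in
        \<open>ZX\<close>.\<close>
      case 3
      have w: "\<phi> w \<noteq> u" "\<phi> w \<noteq> v" using 3 u v V by auto
      have uvK: "u \<in> \<phi> ` P \<and> v \<in> \<phi> ` P"
      proof (rule ccontr)
        assume "\<not> ?thesis"
        then have "{\<phi> f, \<phi> g} \<noteq> {u, v}" if "f \<in> P" "g \<in> P" for f g
          using that by (metis doubleton_eq_iff imageI)
        then have "partial_copy r adj P V \<phi>" using \<phi> by (auto simp: partial_copy_def)
        then show False using free by blast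
      qed
      have "adj (\<phi> w) (\<phi> f)" if "f \<in> P" "f \<noteq> w" for f
        using \<phi> P(2) P(3)[OF that] that w by (auto simp: partial_copy_def doubleton_eq_iff)
      then have "adj (\<phi> w) u" "adj (\<phi> w) v" using uvK w by auto
      then have "u \<in> ZX \<or> v \<in> ZY" using 3 TAB u v by (auto simp: ZX_def ZY_def intro: adj_sym)
      then show ?thesis using u'[of 0] v'[of 0] by auto
    qed
  qed

  have "card V = card X + card Y + card T"
    using V XY by (simp add: card_Un_disjoint Int_Un_distrib2)
  moreover have "card (X - GX) = card X - card GX" "card GX \<le> card X"
    using GX(1) XY by (auto intro: card_Diff_subset card_mono finite_subset)
  moreover have "card (Y - GY) = card Y - card GY" "card GY \<le> card Y"
    using GY(1) XY by (auto intro: card_Diff_subset card_mono finite_subset)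
  ultimately have "real (card (X - GX)) + real (card (Y - GY)) \<ge> n - \<tau> - 2 * ((real k + 1) ^ (k + 2) * \<zeta>)"
    using cT cGX cGY n(1) by linarith
  then show ?thesis
    using XY complete by (intro exI[of _ "X - GX"] exI[of _ "Y - GY"]) (auto simp: mult.assoc)
qed

end

section \<open>Saturated graphs\<close>

abbreviation gadj :: "'a sgraph \<Rightarrow> 'a \<Rightarrow> 'a \<Rightarrow> bool" where
  "gadj G x y \<equiv> {x, y} \<in> edges G"

lemma sym_graph_gadj: "fin_simple_graph G \<Longrightarrow> sym_graph (verts G) (gadj G)"
proof
  assume G: "fin_simple_graph G"
  then show "finite (verts G)" by (simp add: fin_simple_graph_def)
  show "gadj G y x" if "gadj G x y" for x y using that by (simp add: insert_commute)
  show "\<not> gadj G x x" for x using G by (auto simp: fin_simple_graph_def)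
qed

text \<open>Handshake lemma, by double counting incidences; sending \<open>y\<close> to
  \<open>{x, y}\<close> matches the neighbours of \<open>x\<close> with the edges at
  \<open>x\<close>.\<close>

lemma pairs_gadj:
  assumes "fin_simple_graph G"
  shows "pairs (gadj G) (verts G) (verts G) = 2 * card (edges G)"
proof -
  have finV: "finite (verts G)" and e: "\<And>e. e \<in> edges G \<Longrightarrow> e \<subseteq> verts G \<and> card e = 2"
    using assms by (auto simp: fin_simple_graph_def)
  have finE: "finite (edges G)"
  proof (rule finite_subset)
    show "edges G \<subseteq> Pow (verts G)" using e by blast
  qed (use finV in simp)
  have "rdeg (gadj G) (verts G) x = rdeg (\<in>) (edges G) x" if "x \<in> verts G" for x
  proof -
    have "bij_betw (\<lambda>y. {x, y}) {y \<in> verts G. {x, y} \<in> edges G} {e \<in> edges G. x \<in> e}"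
      unfolding bij_betw_def
    proof (intro conjI set_eqI iffI)
      show "inj_on (\<lambda>y. {x, y}) {y \<in> verts G. {x, y} \<in> edges G}" by (auto simp: inj_on_def doubleton_eq_iff)
      fix d assume d: "d \<in> {e \<in> edges G. x \<in> e}"
      then obtain y where "d = {x, y}" using e by (auto simp: card_2_iff)
      then show "d \<in> (\<lambda>y. {x, y}) ` {y \<in> verts G. {x, y} \<in> edges G}" using d e by auto
    qed auto
    then show ?thesis unfolding rdeg_def by (rule bij_betw_same_card)
  qed
  then have "pairs (gadj G) (verts G) (verts G) = pairs (\<in>) (verts G) (edges G)"
    by (simp add: pairs_def)
  also have "\<dots> = pairs (\<lambda>e x. x \<in> e) (edges G) (verts G)"
    by (rule pairs_swap[OF finV finE])
  also have "\<dots> = (\<Sum>e\<in>edges G. 2)"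
    unfolding pairs_def rdeg_def
  proof (rule sum.cong[OF refl])
    fix d assume "d \<in> edges G"
    then have "{x \<in> verts G. x \<in> d} = d" "card d = 2" using e by auto
    then show "card {x \<in> verts G. x \<in> d} = 2" by simp
  qed
  finally show ?thesis by simp
qed

lemma contains_copy_iff:
  assumes "fin_simple_graph F"
  shows "contains_copy G F \<longleftrightarrow> (\<exists>\<phi>. partial_copy (gadj F) (gadj G) (verts F) (verts G) \<phi>)"
proof -
  have "(\<forall>e\<in>edges F. \<phi> ` e \<in> edges G) \<longleftrightarrow>
      (\<forall>f\<in>verts F. \<forall>g\<in>verts F. gadj F f g \<longrightarrow> gadj G (\<phi> f) (\<phi> g))" for \<phi>
  proof
    assume a: "\<forall>f\<in>verts F. \<forall>g\<in>verts F. gadj F f g \<longrightarrow> gadj G (\<phi> f) (\<phi> g)"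
    show "\<forall>e\<in>edges F. \<phi> ` e \<in> edges G"
    proof
      fix e assume e: "e \<in> edges F"
      then have "e \<subseteq> verts F" "card e = 2" using assms by (auto simp: fin_simple_graph_def)
      moreover from this obtain x y where "e = {x, y}" by (auto simp: card_2_iff)
      ultimately show "\<phi> ` e \<in> edges G" using a e by auto
    qed
  qed force
  then show ?thesis unfolding contains_copy_def partial_copy_def by simp
qed

lemma contains_copy_add_edge_iff:
  assumes "fin_simple_graph F"
  shows "contains_copy (add_edge u v G) F \<longleftrightarrow>
    (\<exists>\<phi>. partial_copy (gadj F) (\<lambda>x y. gadj G x y \<or> {x, y} = {u, v}) (verts F) (verts G) \<phi>)"
  unfolding contains_copy_iff[OF assms] by (simp add: add_edge_def disj_commute)

text \<open>The part of the apex is a singleton, since any other vertex in it would be adjacent to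
  the apex.\<close>

lemma three_partite_apexE:
  assumes "three_partite F" "w \<in> verts F" "\<forall>v\<in>verts F. v \<noteq> w \<longrightarrow> {w, v} \<in> edges F"
  obtains B C where "verts F = insert w (B \<union> C)" "w \<notin> B" "w \<notin> C" "B \<inter> C = {}"
    "independent_in F B" "independent_in F C"
proof -
  obtain A B C where ABC: "A \<union> B \<union> C = verts F" "A \<inter> B = {}" "A \<inter> C = {}" "B \<inter> C = {}"
    "independent_in F A" "independent_in F B" "independent_in F C"
    using assms(1) unfolding three_partite_def by blast
  have single: "S = {w}" if "independent_in F S" "w \<in> S" for S
    using that assms(3) unfolding independent_in_def by blast
  from ABC(1) assms(2) consider "w \<in> A" | "w \<in> B" | "w \<in> C" by blast
  then show thesis
  proof cases
    case 1
    with ABC single[of A] show thesis by (intro that[of B C]) auto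
  next
    case 2
    with ABC single[of B] show thesis by (intro that[of A C]) auto
  next
    case 3
    with ABC single[of C] show thesis by (intro that[of A B]) auto
  qed
qed

text \<open>The apex goes to \<open>x\<close> and the two other parts go into \<open>S\<close> and
  \<open>R\<close>, which are disjoint because a common vertex would be adjacent to itself.\<close>

lemma contains_copy_of_kss:
  assumes F: "fin_simple_graph F" "three_partite F" "w \<in> verts F" "\<forall>v\<in>verts F. v \<noteq> w \<longrightarrow> {w, v} \<in> edges F"
    and G: "fin_simple_graph G" and x: "x \<in> verts G"
    and S: "S \<subseteq> {y\<in>verts G. gadj G x y}" "card S = card (verts F)"
    and R: "R \<subseteq> {y\<in>verts G. gadj G x y}" "card R = card (verts F)"
    and SR: "\<forall>a\<in>S. \<forall>b\<in>R. gadj G a b"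
  shows "contains_copy G F"
proof -
  interpret sym_graph "verts G" "gadj G" using G by (rule sym_graph_gadj)
  interpret F: sym_graph "verts F" "gadj F" using F(1) by (rule sym_graph_gadj)
  obtain B C where BC: "verts F = insert w (B \<union> C)" "w \<notin> B" "w \<notin> C" "B \<inter> C = {}"
    "independent_in F B" "independent_in F C"
    using three_partite_apexE[OF F(2-4)] .
  have fin: "finite B" "finite C" "finite S" "finite R"
    using BC(1) F.finite_V finite_subset[OF S(1)] finite_subset[OF R(1)] finite_V by auto
  have "card B \<le> card S" "card C \<le> card R"
    unfolding S(2) R(2) using F.finite_V BC(1) by (auto intro!: card_mono)
  then obtain \<beta> \<gamma> where \<beta>: "\<beta> ` B \<subseteq> S" "inj_on \<beta> B" and \<gamma>: "\<gamma> ` C \<subseteq> R" "inj_on \<gamma> C"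
    using fin card_le_inj[of B S] card_le_inj[of C R] by auto
  have xN: "x \<notin> S" "x \<notin> R" using S(1) R(1) adj_irrefl by auto
  have dis: "S \<inter> R = {}" using SR adj_irrefl by blast
  define \<psi> where "\<psi> f = (if f = w then x else if f \<in> B then \<beta> f else \<gamma> f)" for f
  have \<psi>: "\<psi> w = x" "\<And>f. f \<in> B \<Longrightarrow> \<psi> f = \<beta> f" "\<And>f. f \<in> C \<Longrightarrow> \<psi> f = \<gamma> f"
    using BC by (auto simp: \<psi>_def)
  have \<psi>S: "\<psi> f \<in> S" if "f \<in> B" for f using that \<psi> \<beta> by auto
  have \<psi>R: "\<psi> f \<in> R" if "f \<in> C" for f using that \<psi> \<gamma> by auto
  have adjx: "gadj G x y" "gadj G y x" if "y \<in> S \<union> R" for y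
    using that S(1) R(1) adj_sym by auto
  have adjSR: "gadj G a b" "gadj G b a" if "a \<in> S" "b \<in> R" for a b
    using that SR adj_sym by auto
  have "partial_copy (gadj F) (gadj G) (verts F) (verts G) \<psi>"
    unfolding partial_copy_def
  proof (intro conjI ballI impI)
    have "inj_on \<psi> B" "inj_on \<psi> C" using \<beta>(2) \<gamma>(2) \<psi> by (auto simp: inj_on_def)
    moreover have im: "\<psi> ` B \<subseteq> S" "\<psi> ` C \<subseteq> R" using \<psi>S \<psi>R by blast+
    then have "\<psi> ` (B - C) \<inter> \<psi> ` (C - B) = {}" using dis by blast
    ultimately have "inj_on \<psi> (B \<union> C)" by (simp only: inj_on_Un)
    moreover have "\<psi> w \<notin> \<psi> ` (B \<union> C - {w})" unfolding \<psi>(1) using im xN by blast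
    ultimately show "inj_on \<psi> (verts F)" unfolding BC(1) by simp
    show "\<psi> ` verts F \<subseteq> verts G"
      unfolding BC(1) image_insert image_Un \<psi>(1) using im S(1) R(1) x by blast
    fix f g assume fg: "f \<in> verts F" "g \<in> verts F" "gadj F f g"
    then have "f \<noteq> g" using F.adj_irrefl by auto
    moreover have "\<not> (f \<in> B \<and> g \<in> B)" "\<not> (f \<in> C \<and> g \<in> C)"
      using fg(3) BC(5,6) by (auto simp: independent_in_def)
    ultimately consider "f = w" "g \<in> B \<union> C" | "g = w" "f \<in> B \<union> C" | "f \<in> B" "g \<in> C" | "f \<in> C" "g \<in> B"
      using fg(1,2) unfolding BC(1) by auto
    then show "gadj G (\<psi> f) (\<psi> g)"
    proof cases
      case 1
      then show ?thesis using \<psi>S \<psi>R \<psi>(1) adjx(1) by auto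
    next
      case 2
      then show ?thesis using \<psi>S \<psi>R \<psi>(1) adjx(2) by auto
    next
      case 3
      then show ?thesis using \<psi>S \<psi>R adjSR(1) by auto
    next
      case 4
      then show ?thesis using \<psi>S \<psi>R adjSR(2) by auto
    qed
  qed
  then show ?thesis using contains_copy_iff[OF F(1)] by blast
qed

text \<open>Here \<open>m\<close> stands for the square root of \<open>n\<close>, and the left-hand
  side is the loss in \<open>ex_large_complete_pair\<close> for \<open>q = m\<close>. As \<mu> is at
  most 3\<delta>n^(3/2), each term is at most a constant times \<delta>n; the hypothesis on
  \<open>2 ^ (k + 1)\<close> absorbs the blocking sets.\<close>

lemma deficiency_estimate:
  fixes k :: nat and m \<mu> \<delta> :: real
  assumes m: "m \<ge> 1" and \<mu>: "\<mu> \<le> 3 * \<delta> * m ^ 3" and k: "2 ^ (k + 1) * real k \<le> \<delta> * m" and \<delta>: "\<delta> \<ge> 0"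
  shows "16 * (real k + 1) * \<mu> / m\<^sup>2 + 2 * (real k + 1) ^ (k + 2) *
      (\<mu> / m + 16 * (real k + 1) * \<mu> / m\<^sup>2 * (real k * m + k) + 2 ^ k * (real k * m + k))
    \<le> (48 * (real k + 1) + 2 * (real k + 1) ^ (k + 2) * (4 + 96 * real k * (real k + 1))) * \<delta> * m\<^sup>2"
proof -
  have "\<mu> / m\<^sup>2 \<le> 3 * \<delta> * m" using \<mu> m by (simp add: divide_simps power2_eq_square power3_eq_cube mult_ac)
  then have "16 * (real k + 1) * (\<mu> / m\<^sup>2) \<le> 16 * (real k + 1) * (3 * \<delta> * m)"
    by (intro mult_left_mono) auto
  then have \<tau>: "16 * (real k + 1) * \<mu> / m\<^sup>2 \<le> 48 * (real k + 1) * \<delta> * m" by (simp add: mult_ac)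
  have "m \<le> m\<^sup>2" using m by (simp add: power2_eq_square)
  then have \<tau>': "48 * (real k + 1) * \<delta> * m \<le> 48 * (real k + 1) * \<delta> * m\<^sup>2"
    using \<delta> by (intro mult_left_mono) auto
  have 1: "\<mu> / m \<le> 3 * \<delta> * m\<^sup>2" using \<mu> m by (simp add: divide_simps power2_eq_square power3_eq_cube mult_ac)
  have L: "real k * m + k \<le> 2 * real k * m" using mult_left_mono[OF m, of "real k"] by (simp add: mult.commute)
  have "16 * (real k + 1) * \<mu> / m\<^sup>2 * (real k * m + k) \<le> 48 * (real k + 1) * \<delta> * m * (2 * real k * m)"
    using \<tau> L m \<delta> by (intro mult_mono) auto
  then have 2: "16 * (real k + 1) * \<mu> / m\<^sup>2 * (real k * m + k) \<le> 96 * real k * (real k + 1) * \<delta> * m\<^sup>2"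
    by (simp add: power2_eq_square mult_ac)
  have "2 ^ k * (real k * m + k) \<le> 2 ^ k * (2 * real k * m)" using L by (intro mult_left_mono) auto
  also have "\<dots> = (2 ^ (k + 1) * real k) * m" by simp
  also have "\<dots> \<le> (\<delta> * m) * m" using k m by (intro mult_right_mono) auto
  finally have 3: "2 ^ k * (real k * m + k) \<le> \<delta> * m\<^sup>2" by (simp add: power2_eq_square mult_ac)
  define Q where "Q = 2 * (real k + 1) ^ (k + 2)"
  have "\<mu> / m + 16 * (real k + 1) * \<mu> / m\<^sup>2 * (real k * m + k) + 2 ^ k * (real k * m + k)
      \<le> (4 + 96 * real k * (real k + 1)) * \<delta> * m\<^sup>2"
    using add_mono[OF add_mono[OF 1 2] 3] by (simp add: algebra_simps)
  then have "Q * (\<mu> / m + 16 * (real k + 1) * \<mu> / m\<^sup>2 * (real k * m + k) + 2 ^ k * (real k * m + k))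
      \<le> Q * ((4 + 96 * real k * (real k + 1)) * \<delta> * m\<^sup>2)"
    by (intro mult_left_mono) (auto simp: Q_def)
  with \<tau> \<tau>' have "16 * (real k + 1) * \<mu> / m\<^sup>2 +
      Q * (\<mu> / m + 16 * (real k + 1) * \<mu> / m\<^sup>2 * (real k * m + k) + 2 ^ k * (real k * m + k))
    \<le> 48 * (real k + 1) * \<delta> * m\<^sup>2 + Q * ((4 + 96 * real k * (real k + 1)) * \<delta> * m\<^sup>2)" by linarith
  also have "\<dots> = (48 * (real k + 1) + Q * (4 + 96 * real k * (real k + 1))) * \<delta> * m\<^sup>2"
    by (simp only: distrib_right mult.assoc)
  finally show ?thesis unfolding Q_def .
qed

text \<open>The version for one fixed proportion \<eta> of lost vertices, with all graphs of order
  \<open>n\<close> treated at once; the final theorem merges these into a single function.\<close>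

lemma ex_large_complete_bipartite_subgraph:
  fixes f :: "nat \<Rightarrow> real"
  assumes F: "fin_simple_graph F" "three_partite F" "w \<in> verts F" "\<forall>v\<in>verts F. v \<noteq> w \<longrightarrow> {w, v} \<in> edges F"
    and f: "f \<in> o(\<lambda>n. real n powr (3 / 2))" and \<eta>: "\<eta> > 0"
  shows "\<forall>\<^sub>F n in sequentially. \<forall>G :: 'b sgraph.
    fin_simple_graph G \<and> card (verts G) = n \<and> saturated F G \<and> real (card (edges G)) \<ge> real (t2 n) - f n \<longrightarrow>
    (\<exists>H. subgraph H G \<and> complete_bipartite H \<and> real (card (verts H)) \<ge> real n - \<eta> * real n)"
proof -
  define k where "k = card (verts F)"
  define \<theta> where "\<theta> = 1 / (64 * (real k + 1))"
  define K where "K = nat \<lceil>4 * real k / \<theta>\<^sup>2\<rceil>"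
  define C where "C = 48 * (real k + 1) + 2 * (real k + 1) ^ (k + 2) * (4 + 96 * real k * (real k + 1))"
  \<comment> \<open>Losing at most n/5 vertices cannot exhaust a part of size at least 2n/5, so both
    sides of the subgraph are nonempty. Below, \<delta> is chosen so that the loss in
    \<open>deficiency_estimate\<close> becomes \<eta>'n.\<close>
  define \<eta>' where "\<eta>' = min \<eta> (1 / 5)"
  define \<delta> where "\<delta> = \<eta>' / C"
  have \<eta>': "\<eta>' > 0" "\<eta>' \<le> \<eta>" "\<eta>' \<le> 1 / 5" using \<eta> by (auto simp: \<eta>'_def)
  have C: "C > 0" unfolding C_def by (intro add_pos_nonneg) auto
  have \<delta>: "\<delta> > 0" using \<eta>' C by (simp add: \<delta>_def)
  have \<theta>: "\<theta> > 0" by (simp add: \<theta>_def)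
  have K: "real K * \<theta>\<^sup>2 \<ge> 4 * real k"
  proof -
    have "4 * real k / \<theta>\<^sup>2 \<le> real K" unfolding K_def by (rule real_nat_ceiling_ge)
    then show ?thesis using \<theta> by (simp add: pos_divide_le_eq)
  qed
  have "\<forall>\<^sub>F n in sequentially. norm (f n) \<le> \<delta> * norm (real n powr (3 / 2))"
    using landau_o.smallD[OF f \<delta>] .
  \<comment> \<open>This absorbs the lower-order part of \<mu> and is the reason for the factor 3 in
    \<open>deficiency_estimate\<close>.\<close>
  moreover have "\<forall>\<^sub>F n in sequentially. 2 + c * real n \<le> \<delta> * sqrt (real n) ^ 3" for c
    using \<delta> by real_asymp
  moreover have "\<forall>\<^sub>F n in sequentially. c \<le> \<delta> * sqrt (real n)" for c
    using \<delta> by real_asymp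
  moreover have "\<forall>\<^sub>F n in sequentially. \<delta> * sqrt (real n) ^ 3 + 1 \<le> \<theta>\<^sup>2 * (real n)\<^sup>2"
    using \<delta> \<theta> by real_asymp
  moreover have "\<forall>\<^sub>F n in sequentially. c \<le> real n / 8" for c
    by real_asymp
  moreover have "\<forall>\<^sub>F n in sequentially. c \<le> real n * \<theta>\<^sup>2" for c
    using \<theta> by real_asymp
  moreover have "\<forall>\<^sub>F n in sequentially. n > c" for c :: nat
    by (rule eventually_gt_at_top)
  ultimately have "\<forall>\<^sub>F n in sequentially. norm (f n) \<le> \<delta> * norm (real n powr (3 / 2)) \<and>
      2 + real k * real n \<le> \<delta> * sqrt (real n) ^ 3 \<and> 2 ^ (k + 1) * real k \<le> \<delta> * sqrt (real n) \<and>
      \<delta> * sqrt (real n) ^ 3 + 1 \<le> \<theta>\<^sup>2 * (real n)\<^sup>2 \<and> real k \<le> real n / 8 \<and> 2 * real K \<le> real n * \<theta>\<^sup>2 \<and>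
      n > 2 ^ K * K \<and> n > 0"
    by (intro eventually_conj)
  then show ?thesis
  proof (eventually_elim, intro allI impI, elim conjE)
    fix n :: nat and G :: "'b sgraph"
    assume f: "norm (f n) \<le> \<delta> * norm (real n powr (3 / 2))"
      and n1: "2 + real k * real n \<le> \<delta> * sqrt (real n) ^ 3" and n2: "2 ^ (k + 1) * real k \<le> \<delta> * sqrt (real n)"
      and n3: "\<delta> * sqrt (real n) ^ 3 + 1 \<le> \<theta>\<^sup>2 * (real n)\<^sup>2" and n4: "real k \<le> real n / 8"
      and n5: "2 * real K \<le> real n * \<theta>\<^sup>2" and n6: "n > 2 ^ K * K" and n7: "n > 0"
      and G: "fin_simple_graph G" "card (verts G) = n" "saturated F G" "real (card (edges G)) \<ge> real (t2 n) - f n"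
    interpret sym_graph "verts G" "gadj G" using G(1) by (rule sym_graph_gadj)
    define m where "m = sqrt (real n)"
    have m: "m \<ge> 1" "m\<^sup>2 = real n" using n7 by (auto simp: m_def)
    \<comment> \<open>The summand 1 covers the rounding in \<open>t2\<close>.\<close>
    define h where "h = \<delta> * m ^ 3 + 1"
    define \<mu> where "\<mu> = 2 * h + k * real n"
    have no_copy: "\<nexists>\<psi>. partial_copy (gadj F) (gadj G) (verts F) (verts G) \<psi>"
      using G(3) contains_copy_iff[OF F(1)] by (auto simp: saturated_def)
    have kfree: "\<not> (\<exists>x\<in>verts G. \<exists>S R. S \<subseteq> {y\<in>verts G. gadj G x y} \<and> R \<subseteq> {y\<in>verts G. gadj G x y} \<and>
      card S = k \<and> card R = k \<and> (\<forall>a\<in>S. \<forall>b\<in>R. gadj G a b))"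
      using contains_copy_of_kss[OF F G(1)] G(3) unfolding k_def saturated_def by blast
    \<comment> \<open>A denser pair of sets would contain a K(k,k) by \<open>kst\<close>, against
      \<open>kfree\<close>.\<close>
    have sparse: "real (pairs (gadj G) S R) \<le> \<theta>\<^sup>2 * (real n)\<^sup>2"
      if "x \<in> verts G" and S: "S \<subseteq> {y\<in>verts G. gadj G x y}" and R: "R \<subseteq> {y\<in>verts G. gadj G x y}" for x S R
    proof (rule ccontr)
      assume neg: "\<not> ?thesis"
      have SV: "S \<subseteq> verts G" "R \<subseteq> verts G" using S R by auto
      then have "finite S" "finite R" "card S \<le> n" "card R \<le> n"
        using finite_V G(2) finite_subset card_mono by auto
      then have "\<exists>S'\<subseteq>S. \<exists>R'\<subseteq>R. card S' = k \<and> card R' = k \<and> (\<forall>x\<in>S'. \<forall>y\<in>R'. gadj G x y)"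
        using neg \<theta> K n5 n6 by (intro kst[where \<epsilon> = "\<theta>\<^sup>2" and n = n and K = K]) auto
      then obtain S' R' where S'R': "S' \<subseteq> S" "R' \<subseteq> R" "card S' = k" "card R' = k" "\<forall>x\<in>S'. \<forall>y\<in>R'. gadj G x y"
        by blast
      have "S' \<subseteq> {y\<in>verts G. gadj G x y}" "R' \<subseteq> {y\<in>verts G. gadj G x y}"
        using subset_trans[OF S'R'(1) S] subset_trans[OF S'R'(2) R] .
      then show False using kfree that(1) S'R'(3-5) by blast
    qed
    have m3: "real n powr (3 / 2) = m ^ 3"
    proof -
      have "real n powr (3 / 2) = (real n powr (1 / 2)) powr 3" by (simp add: powr_powr)
      then show ?thesis using n7 by (simp add: m_def powr_half_sqrt powr_numeral)
    qed
    have "real n ^ 2 / 4 - 1 \<le> real (t2 n)"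
    proof -
      have "n\<^sup>2 \<le> 4 * t2 n + 3" unfolding t2_def by presburger
      then have "real (n\<^sup>2) \<le> real (4 * t2 n + 3)" by (rule of_nat_mono)
      then show ?thesis by simp
    qed
    moreover have "f n \<le> \<delta> * m ^ 3" using f m unfolding m3 by simp
    ultimately have "real (card (edges G)) \<ge> (real n)\<^sup>2 / 4 - h" using G(4) unfolding h_def by linarith
    then have dense: "real (pairs (gadj G) (verts G) (verts G)) \<ge> (real n)\<^sup>2 / 2 - 2 * h"
      using pairs_gadj[OF G(1)] by simp
    have h: "0 \<le> h" "h \<le> \<theta>\<^sup>2 * (real n)\<^sup>2" using \<delta> m n3 by (auto simp: h_def m_def)
    have "\<exists>A\<subseteq>verts G. real (card A) \<ge> 2 / 5 * n \<and> real (card (verts G - A)) \<ge> 2 / 5 * n \<and>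
      real (pairs (\<lambda>x y. \<not> gadj G x y) A (verts G - A)) \<le> 2 * h + real k * real n"
      by (rule cut_structure[OF kfree sparse dense _ n4 _ h \<theta>_def]) (use G(2) n7 in simp_all)
    then obtain A where A: "A \<subseteq> verts G" "real (card A) \<ge> 2 / 5 * n" "real (card (verts G - A)) \<ge> 2 / 5 * n"
      "real (pairs (\<lambda>x y. \<not> gadj G x y) A (verts G - A)) \<le> \<mu>"
      unfolding \<mu>_def by blast
    have "\<exists>A' B'. A' \<subseteq> A \<and> B' \<subseteq> verts G - A \<and> (\<forall>a\<in>A'. \<forall>b\<in>B'. gadj G a b) \<and>
      real (card A') + real (card B') \<ge> real n - 16 * (real k + 1) * \<mu> / real n - 2 * (real k + 1) ^ (k + 2) *
        (\<mu> / m + 16 * (real k + 1) * \<mu> / real n * (real k * m + k) + 2 ^ k * (real k * m + k))"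
    proof (rule ex_large_complete_pair[OF kfree _ _ A(2,3) _ _ n4 A(4) _ F(3) _ _ k_def[symmetric] no_copy])
      show "\<exists>\<phi>. partial_copy (gadj F) (\<lambda>x y. gadj G x y \<or> {x, y} = {u, v}) (verts F) (verts G) \<phi>"
        if "u \<in> verts G" "v \<in> verts G" "u \<noteq> v" "\<not> gadj G u v" for u v
        using G(3) that contains_copy_add_edge_iff[OF F(1), of u v G] by (auto simp: saturated_def)
      show "finite (verts F)" using F(1) by (simp add: fin_simple_graph_def)
      show "gadj F w v" if "v \<in> verts F" "v \<noteq> w" for v using F(4) that by blast
      show "gadj F y x" if "gadj F x y" for x y using that by (simp add: insert_commute)
    qed (use A(1) G(2) n7 m in auto)
    then obtain A' B' where AB': "A' \<subseteq> A" "B' \<subseteq> verts G - A" "\<forall>a\<in>A'. \<forall>b\<in>B'. gadj G a b"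
      and card: "real (card A') + real (card B') \<ge> real n - (16 * (real k + 1) * \<mu> / real n + 2 * (real k + 1) ^ (k + 2) *
        (\<mu> / m + 16 * (real k + 1) * \<mu> / real n * (real k * m + k) + 2 ^ k * (real k * m + k)))"
      by (auto simp: diff_diff_eq)
    have "\<mu> \<le> 3 * \<delta> * m ^ 3" using n1 by (simp add: \<mu>_def h_def m_def)
    then have "16 * (real k + 1) * \<mu> / real n + 2 * (real k + 1) ^ (k + 2) *
        (\<mu> / m + 16 * (real k + 1) * \<mu> / real n * (real k * m + k) + 2 ^ k * (real k * m + k)) \<le> C * \<delta> * real n"
      using deficiency_estimate[of m \<mu> \<delta> k] m n2 \<delta> unfolding C_def m_def[symmetric] by simp
    also have "C * \<delta> * real n = \<eta>' * real n" using C by (simp add: \<delta>_def)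
    finally have large: "real (card A') + real (card B') \<ge> real n - \<eta>' * real n" using card by linarith
    have fin: "finite A'" "finite B'" and dis: "A' \<inter> B' = {}"
      using AB'(1,2) A(1) finite_V finite_subset by (blast intro: finite_subset)+
    have "real (card A) + real (card (verts G - A)) = real n"
      using card_mono[OF finite_V A(1)] A(1) finite_V G(2)
      by (simp add: card_Diff_subset finite_subset of_nat_diff)
    moreover have "real (card A') \<le> real (card A)" "real (card B') \<le> real (card (verts G - A))"
      using AB'(1,2) A(1) finite_V by (auto intro!: card_mono intro: finite_subset)
    moreover have "\<eta>' * real n \<le> 1 / 5 * real n" using \<eta>' by (intro mult_right_mono) auto
    ultimately have "real (card A') > 0" "real (card B') > 0" using large A(2,3) n7 by linarith+
    then have ne: "A' \<noteq> {}" "B' \<noteq> {}" by auto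
    define H where "H = \<lparr>verts = A' \<union> B', edges = {{a, b} | a b. a \<in> A' \<and> b \<in> B'}\<rparr>"
    have "card {a, b} = 2" if "a \<in> A'" "b \<in> B'" for a b using that dis by (auto simp: card_2_iff')
    then have "fin_simple_graph H" using fin by (auto simp: fin_simple_graph_def H_def)
    then have "subgraph H G" using AB' A(1) by (auto simp: subgraph_def H_def)
    moreover have "complete_bipartite H" using ne dis by (auto simp: complete_bipartite_def H_def)
    moreover have "real (card (verts H)) \<ge> real n - \<eta> * real n"
    proof -
      have "\<eta>' * real n \<le> \<eta> * real n" using \<eta>' by (intro mult_right_mono) auto
      then show ?thesis using large fin dis by (simp add: H_def card_Un_disjoint)
    qed
    ultimately show "\<exists>H. subgraph H G \<and> complete_bipartite H \<and> real (card (verts H)) \<ge> real n - \<eta> * real n"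
      by blast
  qed
qed

theorem theorem1p8:
  fixes F :: "'a sgraph" and w :: 'a and f :: "nat \<Rightarrow> real"
  assumes "fin_simple_graph F"
    and "three_partite F"
    and "w \<in> verts F"
    and "\<forall>v\<in>verts F. v \<noteq> w \<longrightarrow> {w, v} \<in> edges F"
    and "f \<in> o(\<lambda>n. real n powr (3 / 2))"
  shows "\<exists>g :: nat \<Rightarrow> real. g \<in> o(\<lambda>n. real n) \<and>
    (\<forall>n. \<forall>G :: 'b sgraph.
       fin_simple_graph G \<and> card (verts G) = n \<and> saturated F G \<and>
       real (card (edges G)) \<ge> real (t2 n) - f n \<longrightarrow>
       (\<exists>H. subgraph H G \<and> complete_bipartite H \<and>
            real (card (verts H)) \<ge> real n - g n))"
proof -
  define good where "good n d \<longleftrightarrow> (\<forall>G :: 'b sgraph.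
    fin_simple_graph G \<and> card (verts G) = n \<and> saturated F G \<and> real (card (edges G)) \<ge> real (t2 n) - f n \<longrightarrow>
    (\<exists>H. subgraph H G \<and> complete_bipartite H \<and> real (card (verts H)) \<ge> real n - real d))" for n d :: nat
  \<comment> \<open>The least loss that works for all graphs of order \<open>n\<close>. It exists
    because losing all \<open>n\<close> vertices is always admissible, with the null graph as
    witness.\<close>
  define g where "g n = real (LEAST d. good n d)" for n
  have "good n n" for n
  proof -
    have "subgraph \<lparr>verts = {}, edges = {}\<rparr> G" "complete_bipartite \<lparr>verts = {}, edges = {}\<rparr>" for G :: "'b sgraph"
      by (auto simp: subgraph_def fin_simple_graph_def complete_bipartite_def)
    then show ?thesis unfolding good_def by (intro allI impI exI[of _ "\<lparr>verts = {}, edges = {}\<rparr>"]) simp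
  qed
  then have good: "good n (LEAST d. good n d)" for n by (rule LeastI)
  have "g \<in> o(\<lambda>n. real n)"
  proof (rule landau_o.smallI)
    fix c :: real assume c: "c > 0"
    show "\<forall>\<^sub>F n in sequentially. norm (g n) \<le> c * norm (real n)"
      using ex_large_complete_bipartite_subgraph[OF assms c, where ?'b = 'b]
    proof eventually_elim
      case (elim n)
      \<comment> \<open>Orders of graphs are integers, so the real loss \<open>c * n\<close> may be
        rounded down and compared with the least natural number.\<close>
      have fl: "real n - real (nat \<lfloor>c * real n\<rfloor>) \<le> real N" if "real n - c * real n \<le> real N" for N
      proof -
        have "of_int (int n - int N) \<le> c * real n" using that by simp
        then have "int n - int N \<le> \<lfloor>c * real n\<rfloor>" by (simp only: le_floor_iff)
        then show ?thesis by linarith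
      qed
      have "good n (nat \<lfloor>c * real n\<rfloor>)" unfolding good_def using elim fl by blast
      then have "(LEAST d. good n d) \<le> nat \<lfloor>c * real n\<rfloor>" by (rule Least_le)
      then have "g n \<le> real (nat \<lfloor>c * real n\<rfloor>)" by (simp add: g_def)
      also have "\<dots> \<le> c * real n" using c by (simp add: of_nat_floor)
      finally show ?case by (simp add: g_def)
    qed
  qed
  moreover have "\<exists>H. subgraph H G \<and> complete_bipartite H \<and> real (card (verts H)) \<ge> real n - g n"
    if "fin_simple_graph G \<and> card (verts G) = n \<and> saturated F G \<and> real (card (edges G)) \<ge> real (t2 n) - f n"
    for n and G :: "'b sgraph"
    using good[of n] that unfolding good_def[of n "LEAST d. good n d"] g_def by blast
  ultimately show ?thesis by blast
qed

end
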